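(* There is an algorithm that solves \textsc{Best Red Response} in time $\mathcal{O}\left(n\cdot(k_\chi+1)^{\tau+2}\right)$, where $n$ is the number of targets, $k_\chi$ is the number of sensor types, and $\tau$ is the (finite) recharging time.
   Context: An Escape Sensing Game (ESG) consists of: a finite set of targets $T=\{t_1,\dots,t_n\}$, each $t_i$ with a value $v_i\in\mathbb{R}^+$; a finite set of sensors $S=\{s_1,\dots,s_k\}$; a recharging time $\tau\in\mathbb{N}\cup\{\infty\}$ common to all sensors; and a sensing matrix $D\in\{0,1\}^{n\times k}$, where $D_{i,j}=1$ means that sensor $s_j$ is capable of sensing target $t_i$. A target ordering is a bijection $\sigma:T\to[n]$. A sensing plan is a map $\psi:S\to 2^T$ with $\psi(s)\cap\psi(s')=\emptyset$ for all $s\neq s'\in S$. The plan $\psi$ is valid with respect to $\sigma$ if (i) for each $s_j\in S$ and $t_i\in\psi(s_j)$ we have $D_{i,j}=1$, and (ii) for each $s\in S$ and all distinct $t,t'\in\psi(s)$ we have $|\sigma(t)-\sigma(t')|>\tau$. The value of not-sensed targets is $v(\psi)=\sum_{t_i\in T\setminus\bigcup_{s\in S}\psi(s)}v_i$. \textsc{Best Red Response}: given an ESG and a target ordering $\sigma$, find a sensing plan $\psi$ that is valid with respect to $\sigma$ and minimizes $v(\psi)$ among all such plans. Two sensors $s_i,s_j$ are of the same type if the $i$-th and $j$-th columns of $D$ are identical; $k_\chi$ denotes the number of distinct sensor types.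
   Formalization: The algorithm receives, besides the game and the ordering, the sensors already grouped by type; from the sensing matrix alone the bound fails, as for one target and recharging time 0 it is constant while finding a capable sensor may need reading all k entries. *)

theory Defs
  imports Complex_Main "HOL-Library.Extended_Nat"
begin

section \<open>Escape sensing games\<close>

text \<open>Targets are the indices below \<^term>\<open>num_targets\<close> and sensors the indices below
  \<^term>\<open>num_sensors\<close>; \<^term>\<open>senses E i j\<close> is the entry \<open>D\<^sub>i\<^sub>j = 1\<close> of the sensing matrix.\<close>

record esg =
  num_targets :: nat
  num_sensors :: nat
  target_value :: "nat \<Rightarrow> real"
  recharge :: enat
  senses :: "nat \<Rightarrow> nat \<Rightarrow> bool"

abbreviation targets :: "esg \<Rightarrow> nat set" where
  "targets E \<equiv> {..<num_targets E}"

abbreviation sensors :: "esg \<Rightarrow> nat set" where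
  "sensors E \<equiv> {..<num_sensors E}"

definition wf_esg :: "esg \<Rightarrow> bool" where
  "wf_esg E \<longleftrightarrow> (\<forall>i\<in>targets E. target_value E i > 0)"

definition target_ordering :: "esg \<Rightarrow> (nat \<Rightarrow> nat) \<Rightarrow> bool" where
  "target_ordering E \<sigma> \<longleftrightarrow> bij_betw \<sigma> (targets E) {1..num_targets E}"

definition sensing_plan :: "esg \<Rightarrow> (nat \<Rightarrow> nat set) \<Rightarrow> bool" where
  "sensing_plan E \<psi> \<longleftrightarrow>
     (\<forall>s\<in>sensors E. \<psi> s \<subseteq> targets E) \<and>
     (\<forall>s\<in>sensors E. \<forall>s'\<in>sensors E. s \<noteq> s' \<longrightarrow> \<psi> s \<inter> \<psi> s' = {})"

definition valid_plan :: "esg \<Rightarrow> (nat \<Rightarrow> nat) \<Rightarrow> (nat \<Rightarrow> nat set) \<Rightarrow> bool" where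
  "valid_plan E \<sigma> \<psi> \<longleftrightarrow>
     sensing_plan E \<psi> \<and>
     (\<forall>s\<in>sensors E. \<forall>t\<in>\<psi> s. senses E t s) \<and>
     (\<forall>s\<in>sensors E. \<forall>t\<in>\<psi> s. \<forall>t'\<in>\<psi> s. t \<noteq> t' \<longrightarrow>
        enat (nat \<bar>int (\<sigma> t) - int (\<sigma> t')\<bar>) > recharge E)"

definition unsensed_value :: "esg \<Rightarrow> (nat \<Rightarrow> nat set) \<Rightarrow> real" where
  "unsensed_value E \<psi> = (\<Sum>i\<in>targets E - (\<Union>s\<in>sensors E. \<psi> s). target_value E i)"

definition best_red_response :: "esg \<Rightarrow> (nat \<Rightarrow> nat) \<Rightarrow> (nat \<Rightarrow> nat set) \<Rightarrow> bool" where
  "best_red_response E \<sigma> = is_arg_min (unsensed_value E) (valid_plan E \<sigma>)"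

definition column :: "esg \<Rightarrow> nat \<Rightarrow> bool list" where
  "column E j = map (\<lambda>i. senses E i j) [0..<num_targets E]"

definition num_types :: "esg \<Rightarrow> nat" where
  "num_types E = card (column E ` sensors E)"


section \<open>A random access machine with step counting\<close>

text \<open>
  Programs are structured programs over natural-number scalars, natural-number arrays and real
  arrays.  The arithmetic is addition and subtraction only: unit-cost multiplication of unbounded
  integers would allow unreasonably fast computations, and arbitrary real constants would allow
  advice to be hidden in the program.  Reals can be stored, added, subtracted and compared, but
  not turned into integers or addresses.
\<close>

type_synonym vname = string

record store =
  nvar :: "vname \<Rightarrow> nat"
  narr :: "vname \<Rightarrow> nat \<Rightarrow> nat"
  rarr :: "vname \<Rightarrow> nat \<Rightarrow> real"

datatype nexp = NConst nat | NVar vname | NArr vname nexp | NPlus nexp nexp | NMinus nexp nexp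

datatype rexp = RArr vname nexp | RPlus rexp rexp | RMinus rexp rexp

datatype bexp = NLess nexp nexp | RLess rexp rexp | BNot bexp | BAnd bexp bexp

datatype com =
    Skip
  | NAssign vname nexp
  | NArrAssign vname nexp nexp
  | RArrAssign vname nexp rexp
  | Seq com com
  | If bexp com com
  | While bexp com

primrec nval :: "nexp \<Rightarrow> store \<Rightarrow> nat" where
  "nval (NConst c) s = c"
| "nval (NVar x) s = nvar s x"
| "nval (NArr x a) s = narr s x (nval a s)"
| "nval (NPlus a b) s = nval a s + nval b s"
| "nval (NMinus a b) s = nval a s - nval b s"

primrec rval :: "rexp \<Rightarrow> store \<Rightarrow> real" where
  "rval (RArr x a) s = rarr s x (nval a s)"
| "rval (RPlus a b) s = rval a s + rval b s"
| "rval (RMinus a b) s = rval a s - rval b s"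

primrec bval :: "bexp \<Rightarrow> store \<Rightarrow> bool" where
  "bval (NLess a b) s \<longleftrightarrow> nval a s < nval b s"
| "bval (RLess a b) s \<longleftrightarrow> rval a s < rval b s"
| "bval (BNot b) s \<longleftrightarrow> \<not> bval b s"
| "bval (BAnd b c) s \<longleftrightarrow> bval b s \<and> bval c s"

definition set_nvar :: "vname \<Rightarrow> nat \<Rightarrow> store \<Rightarrow> store" where
  "set_nvar x c s = s\<lparr>nvar := (nvar s)(x := c)\<rparr>"

definition set_narr :: "vname \<Rightarrow> nat \<Rightarrow> nat \<Rightarrow> store \<Rightarrow> store" where
  "set_narr x i c s = s\<lparr>narr := (narr s)(x := (narr s x)(i := c))\<rparr>"

definition set_rarr :: "vname \<Rightarrow> nat \<Rightarrow> real \<Rightarrow> store \<Rightarrow> store" where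
  "set_rarr x i r s = s\<lparr>rarr := (rarr s)(x := (rarr s x)(i := r))\<rparr>"

text \<open>
  \<open>exec c s t s'\<close>: started in \<open>s\<close>, the program \<open>c\<close> halts in \<open>s'\<close> after \<open>t\<close> steps.  One step is
  charged per assignment, test or skip; the size of the expressions occurring in a program is a
  constant of that program, so charging each operation inside them would only change the time by
  a constant factor.
\<close>

inductive exec :: "com \<Rightarrow> store \<Rightarrow> nat \<Rightarrow> store \<Rightarrow> bool" where
  Skip: "exec Skip s 1 s"
| NAssign: "exec (NAssign x e) s 1 (set_nvar x (nval e s) s)"
| NArrAssign: "exec (NArrAssign x a e) s 1 (set_narr x (nval a s) (nval e s) s)"
| RArrAssign: "exec (RArrAssign x a e) s 1 (set_rarr x (nval a s) (rval e s) s)"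
| Seq: "exec c1 s t1 s' \<Longrightarrow> exec c2 s' t2 s'' \<Longrightarrow> exec (Seq c1 c2) s (t1 + t2) s''"
| IfTrue: "bval b s \<Longrightarrow> exec c1 s t s' \<Longrightarrow> exec (If b c1 c2) s (1 + t) s'"
| IfFalse: "\<not> bval b s \<Longrightarrow> exec c2 s t s' \<Longrightarrow> exec (If b c1 c2) s (1 + t) s'"
| WhileFalse: "\<not> bval b s \<Longrightarrow> exec (While b c) s 1 s"
| WhileTrue: "bval b s \<Longrightarrow> exec c s t1 s' \<Longrightarrow> exec (While b c) s' t2 s'' \<Longrightarrow>
    exec (While b c) s (1 + t1 + t2) s''"


section \<open>Input and output\<close>

text \<open>
  The input is the whole game and the ordering, together with the partition of the sensors into
  types.  The partition cannot be recomputed within a bound that depends on the number of types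
  rather than on the number of sensors: already for one target and recharging time 0, finding a
  sensor that can sense the target in an unstructured row of the matrix means searching the row.
\<close>

definition type_partition :: "esg \<Rightarrow> nat list list \<Rightarrow> bool" where
  "type_partition E gs \<longleftrightarrow>
     distinct (concat gs) \<and> set (concat gs) = sensors E \<and> [] \<notin> set gs \<and>
     (\<forall>a<length gs. \<forall>b<length gs. \<forall>i\<in>set (gs ! a). \<forall>j\<in>set (gs ! b).
        a = b \<longleftrightarrow> column E i = column E j)"

text \<open>
  The matrix is stored row by row.  The sensors of type \<open>c\<close> are stored in the cells
  \<open>start[c], \<dots>, start[c+1] - 1\<close> of the array \<open>sensor\<close>.  Every cell not mentioned is 0.
\<close>

definition input_store :: "esg \<Rightarrow> (nat \<Rightarrow> nat) \<Rightarrow> nat list list \<Rightarrow> store" where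
  "input_store E \<sigma> gs =
    \<lparr> nvar = (\<lambda>_. 0)
        (''n'' := num_targets E, ''k'' := num_sensors E,
         ''tau'' := the_enat (recharge E), ''types'' := length gs),
      narr = (\<lambda>_ _. 0)
        (''sigma'' := (\<lambda>i. if i < num_targets E then \<sigma> i else 0),
         ''D'' := (\<lambda>p. if p < num_targets E * num_sensors E
                       then of_bool (senses E (p div num_sensors E) (p mod num_sensors E)) else 0),
         ''start'' := (\<lambda>c. if c \<le> length gs then length (concat (take c gs)) else 0),
         ''sensor'' := (\<lambda>p. if p < length (concat gs) then concat gs ! p else 0)),
      rarr = (\<lambda>_ _. 0)
        (''v'' := (\<lambda>i. if i < num_targets E then target_value E i else 0)) \<rparr>"

text \<open>The plan is read off an array that holds, for each target, 0 if the target is not sensed and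
  \<open>s + 1\<close> if it is sensed by the sensor \<open>s\<close>.\<close>

definition output_plan :: "esg \<Rightarrow> store \<Rightarrow> nat \<Rightarrow> nat set" where
  "output_plan E st s = {i \<in> targets E. narr st ''plan'' i = s + 1}"

end

theory Submission
  imports Defs
begin

text \<open>
  Only the type of the sensor assigned to each target matters: a sequence of types (0 for a target
  that is not sensed) comes from a valid plan iff every type is able to sense its targets and, among
  any \<open>\<tau> + 1\<close> consecutive targets, occurs at most as often as it has sensors; the sensors of a type
  then take turns.  Hence the types chosen for the last \<open>\<tau>\<close> targets, read as a number \<open>q < M = B\<^sup>\<tau>\<close>
  in base \<open>B = k\<^sub>\<chi> + 1\<close>, suffice as the state of a dynamic program running backwards through the
  ordering: choosing \<open>d\<close> leads to the state \<open>(q * B + d) mod M\<close>, and the values for the last \<open>l\<close>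
  targets are kept in \<open>H[l * M + q]\<close>.  Multiplication and division are avoided by enumerating
  \<open>q * B + d\<close> and its residue modulo \<open>M\<close> with counters, and the numbers of uses of a type in a window
  are tabulated once for all states, so that a transition takes constant time.
\<close>

section \<open>Weakest preconditions with time\<close>

declare One_nat_def [simp del]

definition wp :: "com \<Rightarrow> store \<Rightarrow> (nat \<Rightarrow> store \<Rightarrow> bool) \<Rightarrow> bool" where
  "wp c s Q \<longleftrightarrow> (\<exists>t s'. exec c s t s' \<and> Q t s')"

inductive_cases exec_SkipE: "exec Skip s t s'"
inductive_cases exec_NAssignE: "exec (NAssign x e) s t s'"
inductive_cases exec_NArrAssignE: "exec (NArrAssign x a e) s t s'"
inductive_cases exec_RArrAssignE: "exec (RArrAssign x a e) s t s'"
inductive_cases exec_SeqE: "exec (Seq c1 c2) s t s'"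
inductive_cases exec_IfE: "exec (If b c1 c2) s t s'"

lemma wp_Skip [simp]: "wp Skip s Q \<longleftrightarrow> Q 1 s"
  unfolding wp_def by (auto intro: exec.intros elim!: exec_SkipE)

lemma wp_NAssign [simp]: "wp (NAssign x e) s Q \<longleftrightarrow> Q 1 (set_nvar x (nval e s) s)"
  unfolding wp_def by (auto intro: exec.intros elim!: exec_NAssignE)

lemma wp_NArrAssign [simp]:
  "wp (NArrAssign x a e) s Q \<longleftrightarrow> Q 1 (set_narr x (nval a s) (nval e s) s)"
  unfolding wp_def by (auto intro: exec.intros elim!: exec_NArrAssignE)

lemma wp_RArrAssign [simp]:
  "wp (RArrAssign x a e) s Q \<longleftrightarrow> Q 1 (set_rarr x (nval a s) (rval e s) s)"
  unfolding wp_def by (auto intro: exec.intros elim!: exec_RArrAssignE)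

lemma wp_Seq [simp]:
  "wp (Seq c1 c2) s Q \<longleftrightarrow> wp c1 s (\<lambda>t1 s1. wp c2 s1 (\<lambda>t2 s2. Q (t1 + t2) s2))"
  unfolding wp_def by (auto intro: exec.intros elim!: exec_SeqE)

lemma wp_If [simp]:
  "wp (If b c1 c2) s Q \<longleftrightarrow>
     (if bval b s then wp c1 s (\<lambda>t. Q (1 + t)) else wp c2 s (\<lambda>t. Q (1 + t)))"
proof (cases "bval b s")
  case True
  then show ?thesis
    unfolding wp_def by (auto elim!: exec_IfE intro: exec.IfTrue)
next
  case False
  then show ?thesis
    unfolding wp_def by (auto elim!: exec_IfE intro: exec.IfFalse)
qed

lemma wp_mono: "wp c s Q \<Longrightarrow> (\<And>t s'. Q t s' \<Longrightarrow> R t s') \<Longrightarrow> wp c s R"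
  unfolding wp_def by blast

lemma nvar_set_nvar [simp]: "nvar (set_nvar x c s) y = (if y = x then c else nvar s y)"
  and nvar_set_narr [simp]: "nvar (set_narr a i c s) y = nvar s y"
  and nvar_set_rarr [simp]: "nvar (set_rarr a i r s) y = nvar s y"
  and narr_set_nvar [simp]: "narr (set_nvar x c s) b = narr s b"
  and narr_set_narr [simp]:
    "narr (set_narr a i c s) b = (if b = a then (narr s b)(i := c) else narr s b)"
  and narr_set_rarr [simp]: "narr (set_rarr a i r s) b = narr s b"
  and rarr_set_nvar [simp]: "rarr (set_nvar x c s) b = rarr s b"
  and rarr_set_narr [simp]: "rarr (set_narr a i c s) b = rarr s b"
  and rarr_set_rarr [simp]:
    "rarr (set_rarr a i r s) b = (if b = a then (rarr s b)(i := r) else rarr s b)"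
  by (simp_all add: set_nvar_def set_narr_def set_rarr_def)

primrec nvars_written :: "com \<Rightarrow> vname set" where
  "nvars_written Skip = {}"
| "nvars_written (NAssign x e) = {x}"
| "nvars_written (NArrAssign x a e) = {}"
| "nvars_written (RArrAssign x a e) = {}"
| "nvars_written (Seq c1 c2) = nvars_written c1 \<union> nvars_written c2"
| "nvars_written (If b c1 c2) = nvars_written c1 \<union> nvars_written c2"
| "nvars_written (While b c) = nvars_written c"

primrec narrs_written :: "com \<Rightarrow> vname set" where
  "narrs_written Skip = {}"
| "narrs_written (NAssign x e) = {}"
| "narrs_written (NArrAssign x a e) = {x}"
| "narrs_written (RArrAssign x a e) = {}"
| "narrs_written (Seq c1 c2) = narrs_written c1 \<union> narrs_written c2"
| "narrs_written (If b c1 c2) = narrs_written c1 \<union> narrs_written c2"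
| "narrs_written (While b c) = narrs_written c"

primrec rarrs_written :: "com \<Rightarrow> vname set" where
  "rarrs_written Skip = {}"
| "rarrs_written (NAssign x e) = {}"
| "rarrs_written (NArrAssign x a e) = {}"
| "rarrs_written (RArrAssign x a e) = {x}"
| "rarrs_written (Seq c1 c2) = rarrs_written c1 \<union> rarrs_written c2"
| "rarrs_written (If b c1 c2) = rarrs_written c1 \<union> rarrs_written c2"
| "rarrs_written (While b c) = rarrs_written c"

definition frame :: "com \<Rightarrow> store \<Rightarrow> store \<Rightarrow> bool" where
  "frame c s s' \<longleftrightarrow>
     (\<forall>x. x \<notin> nvars_written c \<longrightarrow> nvar s' x = nvar s x) \<and>
     (\<forall>x. x \<notin> narrs_written c \<longrightarrow> narr s' x = narr s x) \<and>
     (\<forall>x. x \<notin> rarrs_written c \<longrightarrow> rarr s' x = rarr s x)"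

lemma frame_refl: "frame c s s"
  by (simp add: frame_def)

lemma frame_trans: "frame c s s' \<Longrightarrow> frame c s' s'' \<Longrightarrow> frame c s s''"
  by (simp add: frame_def)

lemma frame_nvar: "frame c s s' \<Longrightarrow> x \<notin> nvars_written c \<Longrightarrow> nvar s' x = nvar s x"
  and frame_narr: "frame c s s' \<Longrightarrow> x \<notin> narrs_written c \<Longrightarrow> narr s' x = narr s x"
  and frame_rarr: "frame c s s' \<Longrightarrow> x \<notin> rarrs_written c \<Longrightarrow> rarr s' x = rarr s x"
  by (simp_all add: frame_def)

lemma exec_frame: "exec c s t s' \<Longrightarrow> frame c s s'"
  by (induction rule: exec.induct) (simp_all add: frame_def)

lemma wp_frame: "wp c s Q \<Longrightarrow> wp c s (\<lambda>t s'. Q t s' \<and> frame c s s')"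
  unfolding wp_def using exec_frame by blast

lemma wp_While:
  assumes init: "I 0 s0"
    and step: "\<And>j s. j < N \<Longrightarrow> I j s \<Longrightarrow> frame c s0 s \<Longrightarrow>
      bval b s \<and> wp c s (\<lambda>t s'. t \<le> T \<and> I (Suc j) s')"
    and exit: "\<And>s. I N s \<Longrightarrow> frame c s0 s \<Longrightarrow> \<not> bval b s"
    and post: "\<And>t s. t \<le> N * (T + 1) + 1 \<Longrightarrow> I N s \<Longrightarrow> frame c s0 s \<Longrightarrow> Q t s"
  shows "wp (While b c) s0 Q"
proof -
  have "\<exists>t s'. exec (While b c) s t s' \<and> t \<le> d * (T + 1) + 1 \<and> I N s' \<and> frame c s0 s'"
    if "I j s" "frame c s0 s" "j + d = N" for d j s
    using that
  proof (induction d arbitrary: j s)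
    case 0
    then show ?case using exit[of s] WhileFalse[of b s c] by auto
  next
    case (Suc d)
    obtain t s' where 1: "exec c s t s'" "t \<le> T" "I (Suc j) s'"
      using step[of j s] Suc.prems unfolding wp_def by auto
    have fr: "frame c s0 s'" using Suc.prems(2) exec_frame[OF 1(1)] frame_trans by blast
    obtain t' s'' where 2: "exec (While b c) s' t' s''" "t' \<le> d * (T + 1) + 1" "I N s''"
      "frame c s0 s''"
      using Suc.IH[OF 1(3) fr] Suc.prems(3) by auto
    have "exec (While b c) s (1 + t + t') s''"
      using WhileTrue 1(1) 2(1) step[of j s] Suc.prems by auto
    moreover have "1 + t + t' \<le> Suc d * (T + 1) + 1" using 1(2) 2(2) by simp
    ultimately show ?case using 2 by blast
  qed
  from this[of 0 s0 N] init frame_refl post show ?thesis unfolding wp_def by (metis add_0)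
qed


section \<open>The program\<close>

notation Seq (infixr ";;" 60)

abbreviation inc :: "vname \<Rightarrow> com" where
  "inc x \<equiv> NAssign x (NPlus (NVar x) (NConst 1))"

definition power_prog :: com where
  "power_prog =
    NAssign ''B'' (NPlus (NVar ''types'') (NConst 1));;
    NAssign ''M'' (NConst 1);;
    NAssign ''j'' (NConst 0);;
    While (NLess (NVar ''j'') (NVar ''tau''))
     (NAssign ''acc'' (NConst 0);;
      NAssign ''e'' (NConst 0);;
      While (NLess (NVar ''e'') (NVar ''B''))
       (NAssign ''acc'' (NPlus (NVar ''acc'') (NVar ''M''));;
        inc ''e'');;
      NAssign ''M'' (NVar ''acc'');;
      inc ''j'')"

definition index_prog :: com where
  "index_prog =
    NAssign ''i'' (NConst 0);;
    NAssign ''o'' (NConst 0);;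
    While (NLess (NVar ''i'') (NVar ''n''))
     (NArrAssign ''inv'' (NArr ''sigma'' (NVar ''i'')) (NVar ''i'');;
      NArrAssign ''row'' (NVar ''i'') (NVar ''o'');;
      NAssign ''o'' (NPlus (NVar ''o'') (NVar ''k''));;
      inc ''i'')"

definition count_inner :: com where
  "count_inner =
    While (NLess (NVar ''d'') (NVar ''B''))
     (If (BAnd (BNot (NLess (NVar ''d'') (NVar ''e''))) (BNot (NLess (NVar ''e'') (NVar ''d''))))
        (NArrAssign ''cnt'' (NVar ''y'')
          (NPlus (NArr ''cnt'' (NPlus (NVar ''p'') (NVar ''d''))) (NConst 1)))
        (NArrAssign ''cnt'' (NVar ''y'') (NArr ''cnt'' (NPlus (NVar ''p'') (NVar ''d''))));;
      inc ''y'';;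
      inc ''d'')"

definition count_prog :: com where
  "count_prog =
    NAssign ''q'' (NConst 0);;
    NAssign ''p'' (NConst 0);;
    NAssign ''e'' (NConst 0);;
    NAssign ''y'' (NConst 0);;
    While (NLess (NVar ''q'') (NVar ''M''))
     (NAssign ''d'' (NConst 0);;
      count_inner;;
      inc ''q'';;
      inc ''e'';;
      If (NLess (NVar ''e'') (NVar ''B''))
        Skip
        (NAssign ''e'' (NConst 0);; NAssign ''p'' (NPlus (NVar ''p'') (NVar ''B''))))"

definition wrap_prog :: com where
  "wrap_prog =
    inc ''y'';;
    inc ''r'';;
    If (NLess (NVar ''r'') (NVar ''M'')) Skip (NAssign ''r'' (NConst 0))"

abbreviation new_cell :: nexp where
  "new_cell \<equiv> NPlus (NPlus (NVar ''off'') (NVar ''q'')) (NVar ''M'')"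

abbreviation type_start :: nexp where
  "type_start \<equiv> NArr ''start'' (NMinus (NVar ''d'') (NConst 1))"

abbreviation type_size :: nexp where
  "type_size \<equiv> NMinus (NArr ''start'' (NVar ''d'')) type_start"

definition choice_test :: bexp where
  "choice_test =
     BAnd (NLess (NArr ''cnt'' (NVar ''y'')) type_size)
      (BAnd (NLess (NConst 0) (NArr ''D'' (NPlus (NVar ''rw'') (NArr ''sensor'' type_start))))
        (RLess (RArr ''H'' new_cell)
          (RPlus (RArr ''H'' (NPlus (NVar ''off'') (NVar ''r''))) (RArr ''v'' (NVar ''t'')))))"

definition choice_prog :: com where
  "choice_prog =
    While (NLess (NVar ''d'') (NVar ''B''))
     (If choice_test
        (RArrAssign ''H'' new_cell
           (RPlus (RArr ''H'' (NPlus (NVar ''off'') (NVar ''r''))) (RArr ''v'' (NVar ''t'')));;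
         NArrAssign ''cd'' (NPlus (NVar ''off'') (NVar ''q'')) (NVar ''d'');;
         NArrAssign ''cr'' (NPlus (NVar ''off'') (NVar ''q'')) (NVar ''r''))
        Skip;;
      wrap_prog;;
      inc ''d'')"

definition layer_prog :: com where
  "layer_prog =
    NAssign ''q'' (NConst 0);;
    NAssign ''r'' (NConst 0);;
    NAssign ''y'' (NConst 0);;
    While (NLess (NVar ''q'') (NVar ''M''))
     (RArrAssign ''H'' new_cell (RArr ''H'' (NPlus (NVar ''off'') (NVar ''r'')));;
      NArrAssign ''cd'' (NPlus (NVar ''off'') (NVar ''q'')) (NConst 0);;
      NArrAssign ''cr'' (NPlus (NVar ''off'') (NVar ''q'')) (NVar ''r'');;
      wrap_prog;;
      NAssign ''d'' (NConst 1);;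
      choice_prog;;
      inc ''q'')"

definition dp_prog :: com where
  "dp_prog =
    NAssign ''i'' (NVar ''n'');;
    NAssign ''off'' (NConst 0);;
    While (NLess (NConst 0) (NVar ''i''))
     (NAssign ''t'' (NArr ''inv'' (NVar ''i''));;
      NAssign ''rw'' (NArr ''row'' (NVar ''t''));;
      NAssign ''i'' (NMinus (NVar ''i'') (NConst 1));;
      layer_prog;;
      NAssign ''off'' (NPlus (NVar ''off'') (NVar ''M'')))"

definition plan_prog :: com where
  "plan_prog =
    NAssign ''i'' (NConst 0);;
    NAssign ''q'' (NConst 0);;
    While (NLess (NVar ''i'') (NVar ''n''))
     (NAssign ''off'' (NMinus (NVar ''off'') (NVar ''M''));;
      inc ''i'';;
      NAssign ''d'' (NArr ''cd'' (NPlus (NVar ''off'') (NVar ''q'')));;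
      NAssign ''q'' (NArr ''cr'' (NPlus (NVar ''off'') (NVar ''q'')));;
      If (NLess (NConst 0) (NVar ''d''))
        (NArrAssign ''plan'' (NArr ''inv'' (NVar ''i''))
           (NPlus (NArr ''sensor'' (NPlus type_start (NArr ''ptr'' (NVar ''d'')))) (NConst 1));;
         NArrAssign ''ptr'' (NVar ''d'') (NPlus (NArr ''ptr'' (NVar ''d'')) (NConst 1));;
         If (NLess (NArr ''ptr'' (NVar ''d'')) type_size)
           Skip
           (NArrAssign ''ptr'' (NVar ''d'') (NConst 0)))
        Skip)"

definition red_response_prog :: com where
  "red_response_prog =
    If (NLess (NConst 0) (NVar ''types''))
      (power_prog;; index_prog;; count_prog;; dp_prog;; plan_prog)
      Skip"


section \<open>Specifications of the parts\<close>

lemma wp_power_prog: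
  fixes s :: store
  defines "B \<equiv> nvar s ''types'' + 1" and "\<tau> \<equiv> nvar s ''tau''"
  shows "wp power_prog s (\<lambda>t s'. t \<le> 4 + \<tau> * (3 * B + 6) \<and>
    nvar s' ''B'' = B \<and> nvar s' ''M'' = B ^ \<tau>)"
proof -
  have inner: "wp (While (NLess (NVar ''e'') (NVar ''B''))
       (NAssign ''acc'' (NPlus (NVar ''acc'') (NVar ''M''));; inc ''e'')) u
       (\<lambda>t s'. t \<le> 3 * B + 1 \<and> nvar s' ''acc'' = B * nvar u ''M'' \<and>
         nvar s' ''B'' = B \<and> nvar s' ''M'' = nvar u ''M'' \<and> nvar s' ''j'' = nvar u ''j'' \<and>
         nvar s' ''tau'' = nvar u ''tau'')"
    if "nvar u ''acc'' = 0" "nvar u ''e'' = 0" "nvar u ''B'' = B" for u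
  proof (rule wp_While[where N = B and T = 2 and
          I = "\<lambda>j s. nvar s ''e'' = j \<and> nvar s ''acc'' = j * nvar u ''M''"], goal_cases)
    case (2 j v)
    then show ?case using that by (simp add: frame_nvar[OF 2(3)])
  next
    case (3 v)
    then show ?case using that by (simp add: frame_nvar[OF 3(2)])
  next
    case (4 t v)
    then show ?case using that by (simp add: frame_nvar[OF 4(3)])
  qed (use that in simp)
  show ?thesis
    unfolding power_prog_def wp_Seq wp_NAssign
  proof (rule wp_While[where N = \<tau> and T = "3 * B + 5" and
        I = "\<lambda>j s. nvar s ''j'' = j \<and> nvar s ''B'' = B \<and> nvar s ''M'' = B ^ j"], goal_cases)
    case (2 j u)
    have "nvar u ''tau'' = \<tau>" by (simp add: frame_nvar[OF 2(3)] \<tau>_def)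
    then show ?case using 2(1,2) by (simp, intro wp_mono[OF inner]) simp_all
  next
    case (3 u)
    then show ?case by (simp add: frame_nvar[OF 3(2)] \<tau>_def)
  qed (simp_all add: B_def)
qed

lemma wp_index_prog:
  fixes s :: store
  defines "n \<equiv> nvar s ''n''" and "\<sigma> \<equiv> narr s ''sigma''"
  assumes inj: "inj_on \<sigma> {..<n}"
  shows "wp index_prog s (\<lambda>t s'. t \<le> 3 + n * 5 \<and>
    (\<forall>i<n. narr s' ''inv'' (\<sigma> i) = i \<and> narr s' ''row'' i = i * nvar s ''k''))"
  unfolding index_prog_def wp_Seq wp_NAssign
proof (rule wp_While[where N = n and T = 4 and
      I = "\<lambda>j s'. nvar s' ''i'' = j \<and> nvar s' ''o'' = j * nvar s ''k'' \<and>
        (\<forall>i<j. narr s' ''inv'' (\<sigma> i) = i \<and> narr s' ''row'' i = i * nvar s ''k'')"], goal_cases)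
  case (2 j u)
  have "nvar u ''n'' = n" "nvar u ''k'' = nvar s ''k''" "narr u ''sigma'' = \<sigma>"
    by (simp_all add: frame_nvar[OF 2(3)] frame_narr[OF 2(3)] n_def \<sigma>_def)
  moreover have "\<sigma> i \<noteq> \<sigma> j" if "i < j" for i
    using inj that 2(1) by (auto simp: inj_on_def)
  ultimately show ?case using 2(1,2) by (simp add: less_Suc_eq all_conj_distrib)
next
  case (3 u)
  then show ?case by (simp add: frame_nvar[OF 3(2)] n_def)
qed simp_all

text \<open>Meaningful for nonzero digits only, since leading zeros are not counted.\<close>

function digit_count :: "nat \<Rightarrow> nat \<Rightarrow> nat \<Rightarrow> nat" where
  "digit_count B c q =
    (if q = 0 \<or> B < 2 then 0 else of_bool (q mod B = c) + digit_count B c (q div B))"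
  by auto
termination by (relation "measure (\<lambda>(B, c, q). q)") auto

declare digit_count.simps [simp del]

lemma digit_count_0 [simp]: "digit_count B c 0 = 0"
  by (simp add: digit_count.simps)

lemma digit_count_append:
  assumes "B \<ge> 2" "d < B" "c \<noteq> 0"
  shows "digit_count B c (q * B + d) = of_bool (d = c) + digit_count B c q"
  using assms by (subst digit_count.simps) (auto simp: div_mult_self3)

lemma wp_count_prog:
  fixes s :: store
  defines "B \<equiv> nvar s ''B''" and "M \<equiv> nvar s ''M''"
  assumes B: "B \<ge> 2" and zero: "narr s ''cnt'' = (\<lambda>_. 0)"
  shows "wp count_prog s (\<lambda>t s'. t \<le> 5 + M * (5 * B + 8) \<and>
    (\<forall>q<M. \<forall>d<B. d \<noteq> 0 \<longrightarrow> narr s' ''cnt'' (q * B + d) = digit_count B d q))"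
proof -
  define J where "J = (\<lambda>m f. \<forall>q d. d < B \<longrightarrow> d \<noteq> 0 \<longrightarrow>
    f (q * B + d) = (if q * B + d < m then digit_count B d q else 0))"
  have J_D: "f (q * B + d) = (if q * B + d < m then digit_count B d q else 0)"
    if "J m f" "d < B" "d \<noteq> 0" for m f q d
    using that by (simp add: J_def)
  have inner: "wp count_inner u (\<lambda>t s'. t \<le> 5 * B + 1 \<and>
      J (Suc q * B) (narr s' ''cnt'') \<and> nvar s' ''y'' = Suc q * B)"
    if "nvar u ''d'' = 0" "nvar u ''y'' = q * B" "nvar u ''p'' = q div B * B"
      "nvar u ''e'' = q mod B" "nvar u ''B'' = B" "J (q * B) (narr u ''cnt'')" for u q
    unfolding count_inner_def
  proof (rule wp_While[where N = B and T = 4 and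
        I = "\<lambda>j s. nvar s ''d'' = j \<and> nvar s ''y'' = q * B + j \<and> J (q * B + j) (narr s ''cnt'')"], goal_cases)
    case 1
    then show ?case using that by simp
  next
    case (2 j s)
    have fr: "nvar s ''p'' = q div B * B" "nvar s ''e'' = q mod B" "nvar s ''B'' = B"
      using that by (simp_all add: frame_nvar[OF 2(3)])
    note d = 2(2)[THEN conjunct1] and y = 2(2)[THEN conjunct2, THEN conjunct1]
      and J = 2(2)[THEN conjunct2, THEN conjunct2]
    have cell: "narr s ''cnt'' (q div B * B + j) + of_bool (j = q mod B) = digit_count B j q"
      if "j \<noteq> 0"
    proof (cases "q = 0")
      case True
      then show ?thesis using J_D[OF J 2(1) that, of 0] that by simp
    next
      case False
      then have "q div B < q" using B by simp
      then have "Suc (q div B) * B \<le> q * B" by (intro mult_le_mono1) simp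
      then have "q div B * B + B \<le> q * B" by simp
      then have "q div B * B + j < q * B + j" "q div B * B + j < q * B"
        using 2(1) B by linarith+
      then have "narr s ''cnt'' (q div B * B + j) = digit_count B j (q div B)"
        using J_D[OF J 2(1) that, of "q div B"] by simp
      moreover have "digit_count B j q = of_bool (q mod B = j) + digit_count B j (q div B)"
        using digit_count_append[of B "q mod B" j "q div B"] B that by simp
      ultimately show ?thesis by auto
    qed
    have uniq: "q' = q \<and> d' = j" if "q' * B + d' = q * B + j" "d' < B" for q' d'
      using arg_cong[OF that(1), of "\<lambda>x. x div B"] arg_cong[OF that(1), of "\<lambda>x. x mod B"] that(2) 2(1) B
      by simp
    define w where "w = narr s ''cnt'' (q div B * B + j) + of_bool (j = q mod B)"
    have "J (q * B + Suc j) ((narr s ''cnt'')(q * B + j := w))"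
      unfolding J_def
    proof (intro allI impI)
      fix q' d' assume d': "d' < B" "d' \<noteq> 0"
      show "((narr s ''cnt'')(q * B + j := w)) (q' * B + d') =
        (if q' * B + d' < q * B + Suc j then digit_count B d' q' else 0)"
      proof (cases "q' * B + d' = q * B + j")
        case True
        then have "q' = q" "d' = j" using uniq d' by auto
        then show ?thesis using cell d' by (simp add: w_def)
      next
        case False
        then show ?thesis using J_D[OF J d', of q'] by simp
      qed
    qed
    then show ?case using 2(1) d y fr by (cases j "q mod B" rule: linorder_cases) (simp_all add: w_def)
  next
    case (3 s)
    then show ?case using that by (simp add: frame_nvar[OF 3(2)])
  next
    case (4 t s)
    then show ?case by (simp add: algebra_simps)
  qed
  have post: "(\<forall>q<M. \<forall>d<B. d \<noteq> 0 \<longrightarrow> narr s' ''cnt'' (q * B + d) = digit_count B d q)"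
    if "J (M * B) (narr s' ''cnt'')" for s' :: store
  proof (intro allI impI)
    fix q d assume "q < M" "d < B" "d \<noteq> 0"
    moreover from this have "Suc q * B \<le> M * B" by (intro mult_le_mono1) simp
    ultimately show "narr s' ''cnt'' (q * B + d) = digit_count B d q"
      using J_D[OF that, of d q] by simp
  qed
  show ?thesis
    unfolding count_prog_def wp_Seq wp_NAssign
  proof (rule wp_While[where N = M and T = "5 * B + 7" and
        I = "\<lambda>j s. nvar s ''q'' = j \<and> nvar s ''y'' = j * B \<and> nvar s ''p'' = j div B * B \<and>
          nvar s ''e'' = j mod B \<and> J (j * B) (narr s ''cnt'')"], goal_cases)
    case 1
    then show ?case using zero by (simp add: J_def)
  next
    case (2 j u)
    have fr: "nvar u ''M'' = M" "nvar u ''B'' = B"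
      by (simp_all add: frame_nvar[OF 2(3)] count_inner_def B_def M_def)
    have "j mod B < B" using B by simp
    then have wrap: "Suc j mod B = (if Suc (j mod B) < B then Suc (j mod B) else 0)"
      "Suc j div B = (if Suc (j mod B) < B then j div B else Suc (j div B))"
      by (auto simp: mod_Suc div_Suc)
    show ?case using 2(1,2) fr
    proof (simp del: mult_Suc, intro wp_mono[OF wp_frame[OF inner[where q = j]]], goal_cases)
      case (7 t v)
      have "frame count_inner (set_nvar ''d'' 0 u) v" using 7 by blast
      note fr' = frame_nvar[OF this, unfolded count_inner_def]
      show ?case using 7 by (simp add: fr' wrap del: mult_Suc, simp)
    qed simp_all
  next
    case (3 u)
    then show ?case by (simp add: frame_nvar[OF 3(2)] count_inner_def M_def)
  next
    case (4 t u)
    then have "\<forall>q<M. \<forall>d<B. d \<noteq> 0 \<longrightarrow> narr u ''cnt'' (q * B + d) = digit_count B d q"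
      using post by blast
    moreover have "1 + (1 + (1 + (1 + t))) \<le> 5 + M * (5 * B + 8)"
      using 4(1) by (simp add: algebra_simps)
    ultimately show ?case by blast
  qed
qed

definition is_best :: "(nat \<Rightarrow> real) \<Rightarrow> (nat \<Rightarrow> bool) \<Rightarrow> nat \<Rightarrow> nat \<Rightarrow> real \<Rightarrow> bool" where
  "is_best f ok m d x \<longleftrightarrow> d < m \<and> ok d \<and> x = f d \<and> (\<forall>d'<m. ok d' \<longrightarrow> f d' \<le> x)"

lemma is_best_keep:
  "is_best f ok m d x \<Longrightarrow> \<not> (ok m \<and> x < f m) \<Longrightarrow> is_best f ok (Suc m) d x"
  by (auto simp: is_best_def less_Suc_eq not_less)

lemma is_best_replace:
  "is_best f ok m d x \<Longrightarrow> ok m \<Longrightarrow> x < f m \<Longrightarrow> is_best f ok (Suc m) m (f m)"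
  by (fastforce simp: is_best_def less_Suc_eq)

definition store_ok :: "store \<Rightarrow> nat \<Rightarrow> nat \<Rightarrow> nat \<Rightarrow> nat \<Rightarrow> bool" where
  "store_ok s B t q d \<longleftrightarrow> d = 0 \<or>
     narr s ''cnt'' (q * B + d) < narr s ''start'' d - narr s ''start'' (d - 1) \<and>
     0 < narr s ''D'' (narr s ''row'' t + narr s ''sensor'' (narr s ''start'' (d - 1)))"

definition store_gain :: "store \<Rightarrow> nat \<Rightarrow> nat \<Rightarrow> real" where
  "store_gain s t d = (if d = 0 then 0 else rarr s ''v'' t)"

lemma Suc_mod_wrap:
  "0 < M \<Longrightarrow> (x + 1) mod M = (if x mod M + 1 < M then x mod M + 1 else 0)" for M :: nat
  by (metis Suc_eq_plus1 mod_Suc mod_less_divisor Suc_lessI less_irrefl)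

lemma wp_wrap_prog [simp]:
  "wp wrap_prog s Q \<longleftrightarrow> Q 4 (set_nvar ''r'' (if nvar s ''r'' + 1 < nvar s ''M'' then nvar s ''r'' + 1 else 0)
     (set_nvar ''y'' (nvar s ''y'' + 1) s))"
  by (simp add: wrap_prog_def) (simp add: set_nvar_def)

lemma nvars_written_wrap_prog [simp]: "nvars_written wrap_prog = {''y'', ''r''}"
  and narrs_written_wrap_prog [simp]: "narrs_written wrap_prog = {}"
  and rarrs_written_wrap_prog [simp]: "rarrs_written wrap_prog = {}"
  by (auto simp: wrap_prog_def)

lemma wp_choice_prog:
  fixes u :: store and B M off q :: nat
  defines "H \<equiv> rarr u ''H''" and "t \<equiv> nvar u ''t''"
  defines "f \<equiv> \<lambda>d. H (off + (q * B + d) mod M) + store_gain u t d"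
    and "ok \<equiv> store_ok u B t q"
  assumes vars: "nvar u ''B'' = B" "nvar u ''M'' = M" "nvar u ''off'' = off" "nvar u ''q'' = q"
      "nvar u ''rw'' = narr u ''row'' t" "nvar u ''d'' = 1" "nvar u ''y'' = q * B + 1"
      "nvar u ''r'' = (q * B + 1) mod M"
    and B: "1 \<le> B" and M: "0 < M"
    and best0: "is_best f ok 1 0 (H (off + q + M))"
    and cell0: "narr u ''cd'' (off + q) = 0" "narr u ''cr'' (off + q) = q * B mod M"
  shows "wp choice_prog u (\<lambda>time s. time \<le> 10 * B \<and>
    nvar s ''y'' = Suc q * B \<and> nvar s ''r'' = Suc q * B mod M \<and>
    (\<exists>d x. is_best f ok B d x \<and> rarr s ''H'' = H(off + q + M := x) \<and>
      narr s ''cd'' = (narr u ''cd'')(off + q := d) \<and>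
      narr s ''cr'' = (narr u ''cr'')(off + q := (q * B + d) mod M)))"
  unfolding choice_prog_def
proof (rule wp_While[where N = "B - 1" and T = 9 and I = "\<lambda>j s. nvar s ''d'' = Suc j \<and>
    nvar s ''y'' = q * B + Suc j \<and> nvar s ''r'' = (q * B + Suc j) mod M \<and>
    (\<exists>d x. is_best f ok (Suc j) d x \<and> rarr s ''H'' = H(off + q + M := x) \<and>
      narr s ''cd'' = (narr u ''cd'')(off + q := d) \<and>
      narr s ''cr'' = (narr u ''cr'')(off + q := (q * B + d) mod M))"], goal_cases)
  case 1
  have "H = H(off + q + M := H (off + q + M))"
    "narr u ''cd'' = (narr u ''cd'')(off + q := 0)"
    "narr u ''cr'' = (narr u ''cr'')(off + q := (q * B + 0) mod M)"
    using cell0 by (auto simp: fun_eq_iff)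
  then show ?case using vars best0 unfolding H_def One_nat_def by blast
next
  case (2 j s)
  obtain d x where best: "is_best f ok (Suc j) d x" and arrs: "rarr s ''H'' = H(off + q + M := x)"
    "narr s ''cd'' = (narr u ''cd'')(off + q := d)"
    "narr s ''cr'' = (narr u ''cr'')(off + q := (q * B + d) mod M)"
    using 2(2) by blast
  have scal: "nvar s ''d'' = Suc j" "nvar s ''y'' = q * B + Suc j"
    "nvar s ''r'' = (q * B + Suc j) mod M"
    using 2(2) by blast+
  note fr = vars scal frame_nvar[OF 2(3)] frame_narr[OF 2(3)] frame_rarr[OF 2(3)]
  have "(q * B + Suc j) mod M < M" using M by simp
  then have neq: "(q * B + Suc j) mod M \<noteq> q + M" "Suc (q * B + j) mod M \<noteq> q + M" by auto
  have f: "f (Suc j) = H (off + (q * B + Suc j) mod M) + rarr u ''v'' t"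
    by (simp add: f_def store_gain_def)
  have test: "bval choice_test s \<longleftrightarrow> ok (Suc j) \<and> x < f (Suc j)"
    using f neq by (simp add: choice_test_def fr ok_def store_ok_def arrs t_def del: add_Suc_right)
  have wrap: "(q * B + Suc (Suc j)) mod M =
      (if (q * B + Suc j) mod M + 1 < M then (q * B + Suc j) mod M + 1 else 0)"
  proof -
    have "q * B + Suc (Suc j) = (q * B + Suc j) + 1" by simp
    then show ?thesis by (simp only: Suc_mod_wrap[OF M])
  qed
  have loop: "Suc j < B" using 2(1) by simp
  show ?case
  proof (cases "ok (Suc j) \<and> x < f (Suc j)")
    case True
    then have "is_best f ok (Suc (Suc j)) (Suc j) (f (Suc j))"
      using is_best_replace[OF best] by blast
    moreover have "bval choice_test s = True" using test True by simp
    ultimately show ?thesis using loop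
      by (simp add: fr wrap arrs neq t_def[symmetric] del: add_Suc_right)
         (intro exI[of _ "Suc j"] exI[of _ "f (Suc j)"], simp add: f)
  next
    case False
    then have "is_best f ok (Suc (Suc j)) d x" using is_best_keep[OF best] by blast
    moreover have "bval choice_test s = False" using test False by simp
    ultimately show ?thesis using loop
      by (simp add: fr wrap arrs del: add_Suc_right)
         (intro exI[of _ d] exI[of _ x], simp)
  qed
next
  case (3 s)
  then show ?case using vars B by (simp add: frame_nvar[OF 3(2)])
next
  case (4 time s)
  then show ?case using B by (simp add: add.commute)
qed

lemma wp_layer_prog:
  fixes u :: store and B M off :: nat
  defines "H \<equiv> rarr u ''H''" and "t \<equiv> nvar u ''t''"
  assumes vars: "nvar u ''B'' = B" "nvar u ''M'' = M" "nvar u ''off'' = off"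
      "nvar u ''rw'' = narr u ''row'' t"
    and B: "1 \<le> B" and M: "0 < M"
  shows "wp layer_prog u (\<lambda>time s. time \<le> 4 + M * (10 * B + 11) \<and>
    (\<forall>x<off + M. rarr s ''H'' x = H x) \<and>
    (\<forall>x<off. narr s ''cd'' x = narr u ''cd'' x \<and> narr s ''cr'' x = narr u ''cr'' x) \<and>
    (\<forall>q<M. is_best (\<lambda>d. H (off + (q * B + d) mod M) + store_gain u t d) (store_ok u B t q) B
        (narr s ''cd'' (off + q)) (rarr s ''H'' (off + q + M)) \<and>
      narr s ''cr'' (off + q) = (q * B + narr s ''cd'' (off + q)) mod M))"
  unfolding layer_prog_def wp_Seq wp_NAssign
proof (rule wp_While[where N = M and T = "10 * B + 10" and I = "\<lambda>j s. nvar s ''q'' = j \<and>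
    nvar s ''y'' = j * B \<and> nvar s ''r'' = j * B mod M \<and>
    (\<forall>x<off + M. rarr s ''H'' x = H x) \<and>
    (\<forall>x<off. narr s ''cd'' x = narr u ''cd'' x \<and> narr s ''cr'' x = narr u ''cr'' x) \<and>
    (\<forall>q<j. is_best (\<lambda>d. H (off + (q * B + d) mod M) + store_gain u t d) (store_ok u B t q) B
        (narr s ''cd'' (off + q)) (rarr s ''H'' (off + q + M)) \<and>
      narr s ''cr'' (off + q) = (q * B + narr s ''cd'' (off + q)) mod M)"], goal_cases)
  case 1
  then show ?case by (simp add: H_def)
next
  case (2 j s)
  note fr = vars frame_nvar[OF 2(3), unfolded choice_prog_def]
    frame_narr[OF 2(3), unfolded choice_prog_def] frame_rarr[OF 2(3), unfolded choice_prog_def]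
  have scal: "nvar s ''q'' = j" "nvar s ''y'' = j * B" "nvar s ''r'' = j * B mod M"
    using 2(2) by blast+
  have low: "rarr s ''H'' x = H x" if "x < off + M" for x using 2(2) that by blast
  note wrap = Suc_mod_wrap[OF M, of "j * B"]
  have lt: "x mod M < M" for x using M by simp
  have lt_off: "off + x mod M < off + M" "off + x mod M \<noteq> off + j + M" for x
    using lt[of x] by simp_all
  define u' where "u' = set_nvar ''d'' 1 (set_nvar ''r'' ((j * B + 1) mod M)
    (set_nvar ''y'' (j * B + 1) (set_narr ''cr'' (off + j) (j * B mod M)
    (set_narr ''cd'' (off + j) 0 (set_rarr ''H'' (off + j + M) (H (off + j * B mod M)) s)))))"
  note fr' = fr scal
  have t': "nvar u' ''t'' = t" and cnt': "store_ok u' B t j = store_ok u B t j"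
    and gain': "store_gain u' t = store_gain u t"
    by (simp_all add: u'_def fr' t_def store_ok_def store_gain_def fun_eq_iff)
  have H': "rarr u' ''H'' = (rarr s ''H'')(off + j + M := H (off + j * B mod M))"
    and cd': "narr u' ''cd'' = (narr s ''cd'')(off + j := 0)"
    and cr': "narr u' ''cr'' = (narr s ''cr'')(off + j := j * B mod M)"
    by (simp_all add: u'_def)
  have read': "rarr u' ''H'' (off + x mod M) = H (off + x mod M)" for x
    using lt_off[of x] low by (simp add: H')
  define f where "f = (\<lambda>d. H (off + (j * B + d) mod M) + store_gain u t d)"
  have choice: "wp choice_prog u' (\<lambda>time s'. time \<le> 10 * B \<and>
    nvar s' ''y'' = Suc j * B \<and> nvar s' ''r'' = Suc j * B mod M \<and>
    (\<exists>d x. is_best f (store_ok u B t j) B d x \<and>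
      rarr s' ''H'' = (rarr u' ''H'')(off + j + M := x) \<and>
      narr s' ''cd'' = (narr u' ''cd'')(off + j := d) \<and>
      narr s' ''cr'' = (narr u' ''cr'')(off + j := (j * B + d) mod M)))"
    using wp_choice_prog[of u' B M off j, unfolded t' cnt' gain' read' f_def[symmetric]] B M
    by (simp add: u'_def fr' t_def is_best_def f_def store_ok_def store_gain_def low lt_off)
  have new: "Suc j * B = j * B + B" by simp
  show ?case using 2(1)
  proof (simp add: fr' low lt_off wrap[symmetric] u'_def[symmetric] cong: if_cong split del: if_split,
      intro wp_mono[OF wp_frame[OF choice]], goal_cases)
    case (1 time s')
    then obtain d x where best: "is_best f (store_ok u B t j) B d x"
      and arrs: "rarr s' ''H'' = (rarr u' ''H'')(off + j + M := x)"
        "narr s' ''cd'' = (narr u' ''cd'')(off + j := d)"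
        "narr s' ''cr'' = (narr u' ''cr'')(off + j := (j * B + d) mod M)"
      by blast
    have "frame choice_prog u' s'" using 1 by blast
    note fr'' = frame_nvar[OF this, unfolded choice_prog_def]
    have "nvar s' ''q'' = j" by (simp add: fr'' u'_def scal)
    then show ?case using 1 2(2) best unfolding arrs H' cd' cr'
      by (simp add: less_Suc_eq all_conj_distrib new f_def)
  qed
next
  case (3 s)
  then show ?case using vars by (simp add: frame_nvar[OF 3(2)] choice_prog_def)
next
  case (4 time s)
  then show ?case by (simp add: algebra_simps)
qed

definition layer_optimal ::
  "(nat \<Rightarrow> real) \<Rightarrow> (nat \<Rightarrow> nat \<Rightarrow> bool) \<Rightarrow> nat \<Rightarrow> nat \<Rightarrow> nat \<Rightarrow> store \<Rightarrow> bool" where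
  "layer_optimal g ok B M l s \<longleftrightarrow> (\<forall>q<M.
     is_best (\<lambda>d. rarr s ''H'' (l * M + (q * B + d) mod M) + g d) (ok q) B
       (narr s ''cd'' (l * M + q)) (rarr s ''H'' (Suc l * M + q)) \<and>
     narr s ''cr'' (l * M + q) = (q * B + narr s ''cd'' (l * M + q)) mod M)"

lemma layer_optimal_cong:
  assumes "layer_optimal g ok B M l s" and "0 < M"
    and "\<And>x. x < Suc (Suc l) * M \<Longrightarrow> rarr s' ''H'' x = rarr s ''H'' x"
    and "\<And>x. x < Suc l * M \<Longrightarrow> narr s' ''cd'' x = narr s ''cd'' x \<and> narr s' ''cr'' x = narr s ''cr'' x"
  shows "layer_optimal g ok B M l s'"
proof -
  have "x mod M < M" for x using assms(2) by simp
  then have "l * M + x mod M < Suc (Suc l) * M" for x by (simp add: trans_less_add1)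
  then show ?thesis using assms(1,3,4) by (simp add: layer_optimal_def)
qed

lemma layer_optimal_set_nvar [simp]:
  "layer_optimal g ok B M l (set_nvar x c s) = layer_optimal g ok B M l s"
  by (simp add: layer_optimal_def)

lemma wp_dp_prog:
  fixes s :: store and B M n :: nat
  defines "g \<equiv> \<lambda>i. store_gain s (narr s ''inv'' (Suc i))"
    and "ok \<equiv> \<lambda>i. store_ok s B (narr s ''inv'' (Suc i))"
  assumes vars: "nvar s ''B'' = B" "nvar s ''M'' = M" "nvar s ''n'' = n"
    and zero: "rarr s ''H'' = (\<lambda>_. 0)" and B: "1 \<le> B" and M: "0 < M"
  shows "wp dp_prog s (\<lambda>time s'. time \<le> 3 + n * (9 + M * (10 * B + 11)) \<and>
    nvar s' ''off'' = n * M \<and> (\<forall>x<M. rarr s' ''H'' x = 0) \<and>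
    (\<forall>l<n. layer_optimal (g (n - Suc l)) (ok (n - Suc l)) B M l s'))"
  unfolding dp_prog_def wp_Seq wp_NAssign
proof (rule wp_While[where N = n and T = "8 + M * (10 * B + 11)" and I = "\<lambda>j s'.
    nvar s' ''i'' = n - j \<and> nvar s' ''off'' = j * M \<and> (\<forall>x<M. rarr s' ''H'' x = 0) \<and>
    (\<forall>l<j. layer_optimal (g (n - Suc l)) (ok (n - Suc l)) B M l s')"], goal_cases)
  case 1
  then show ?case using vars zero by simp
next
  case (2 j u)
  note written = layer_prog_def choice_prog_def
  note fr = vars frame_nvar[OF 2(3), unfolded written] frame_narr[OF 2(3), unfolded written]
    frame_rarr[OF 2(3), unfolded written]
  define t where "t = narr s ''inv'' (n - j)"
  have pos: "Suc (n - Suc j) = n - j" "n - Suc j + 1 = n - j" using 2(1) by simp_all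
  define u' where "u' = set_nvar ''i'' (n - Suc j) (set_nvar ''rw'' (narr s ''row'' t) (set_nvar ''t'' t u))"
  have u': "rarr u' = rarr u" "narr u' = narr u" "nvar u' ''t'' = t" "nvar u' ''off'' = j * M"
    "nvar u' ''M'' = M" "nvar u' ''i'' = n - Suc j"
    using 2(2) by (simp_all add: u'_def fr fun_eq_iff)
  have stat: "store_gain u' = store_gain s" "store_ok u' = store_ok s"
    by (simp_all add: fun_eq_iff u'_def store_gain_def store_ok_def fr)
  have layer: "wp layer_prog u' (\<lambda>time v. time \<le> 4 + M * (10 * B + 11) \<and>
    (\<forall>x<j * M + M. rarr v ''H'' x = rarr u ''H'' x) \<and>
    (\<forall>x<j * M. narr v ''cd'' x = narr u ''cd'' x \<and> narr v ''cr'' x = narr u ''cr'' x) \<and>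
    (\<forall>q<M. is_best (\<lambda>d. rarr u ''H'' (j * M + (q * B + d) mod M) + g (n - Suc j) d)
        (ok (n - Suc j) q) B (narr v ''cd'' (j * M + q)) (rarr v ''H'' (j * M + q + M)) \<and>
      narr v ''cr'' (j * M + q) = (q * B + narr v ''cd'' (j * M + q)) mod M))"
    using wp_layer_prog[of u' B M "j * M"] B M
    by (simp add: u' stat) (simp add: u'_def fr g_def ok_def pos t_def)
  have "bval (NLess (NConst 0) (NVar ''i'')) u" using 2(1,2) by simp
  moreover have "nvar u ''i'' - 1 = n - Suc j" using 2(2) by simp
  ultimately show ?case using 2(2)
  proof (simp add: fr t_def[symmetric] u'_def[symmetric], intro wp_mono[OF wp_frame[OF layer]], goal_cases)
    case (1 time v)
    then have "frame layer_prog u' v" by blast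
    note fr' = frame_nvar[OF this, unfolded written]
    have Hv: "rarr v ''H'' x = rarr u ''H'' x" if "x < j * M + M" for x using 1 that by blast
    have cv: "narr v ''cd'' x = narr u ''cd'' x \<and> narr v ''cr'' x = narr u ''cr'' x"
      if "x < j * M" for x using 1 that by blast
    have "x mod M < M" for x using M by simp
    then have new: "layer_optimal (g (n - Suc j)) (ok (n - Suc j)) B M j v"
      using 1 by (simp add: layer_optimal_def Hv add.commute add.left_commute)
    have old: "layer_optimal (g (n - Suc l)) (ok (n - Suc l)) B M l v" if "l < j" for l
    proof (rule layer_optimal_cong[of _ _ _ _ _ u])
      show "layer_optimal (g (n - Suc l)) (ok (n - Suc l)) B M l u" using 2(2) that by blast
      have "Suc l * M \<le> j * M" using that by (intro mult_le_mono1) simp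
      then show "narr v ''cd'' x = narr u ''cd'' x \<and> narr v ''cr'' x = narr u ''cr'' x"
        if "x < Suc l * M" for x using cv less_le_trans[OF that] by blast
      have "Suc (Suc l) * M \<le> Suc j * M" using that by (intro mult_le_mono1) simp
      then show "rarr v ''H'' x = rarr u ''H'' x" if "x < Suc (Suc l) * M" for x
        using Hv less_le_trans[OF that] by (simp add: add.commute)
    qed (use M in simp)
    have "\<forall>x<M. rarr v ''H'' x = 0" using 2(2) Hv by (simp add: trans_less_add2)
    then show ?case using 1 new old by (simp add: fr' u' less_Suc_eq all_conj_distrib)
  qed
next
  case (3 u)
  then show ?case by simp
next
  case (4 time u)
  then show ?case by (simp add: algebra_simps)
qed

lemma card_less_Suc_eq:
  "card {j. j < Suc i \<and> ds j = c} = card {j. j < i \<and> ds j = c} + of_bool (ds i = c)"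
proof -
  have "{j. j < Suc i \<and> ds j = c} =
      (if ds i = c then insert i {j. j < i \<and> ds j = c} else {j. j < i \<and> ds j = c})"
    by (auto simp: less_Suc_eq)
  then show ?thesis by simp
qed

lemma wp_plan_prog:
  fixes s :: store and M n :: nat and ds qs :: "nat \<Rightarrow> nat"
  defines "m \<equiv> \<lambda>d. narr s ''start'' d - narr s ''start'' (d - 1)"
  defines "rank \<equiv> \<lambda>i d. card {j. j < i \<and> ds j = d} mod m d"
  assumes vars: "nvar s ''M'' = M" "nvar s ''n'' = n" "nvar s ''off'' = n * M"
    and zero: "narr s ''ptr'' = (\<lambda>_. 0)" "narr s ''plan'' = (\<lambda>_. 0)"
    and qs0: "qs 0 = 0"
    and qs: "\<And>i. i < n \<Longrightarrow> qs (Suc i) = narr s ''cr'' ((n - Suc i) * M + qs i)"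
    and ds: "\<And>i. i < n \<Longrightarrow> ds i = narr s ''cd'' ((n - Suc i) * M + qs i)"
    and inj: "\<And>i j. i < j \<Longrightarrow> j < n \<Longrightarrow> narr s ''inv'' (Suc i) \<noteq> narr s ''inv'' (Suc j)"
    and pos: "\<And>i. i < n \<Longrightarrow> ds i \<noteq> 0 \<Longrightarrow> 0 < m (ds i)"
  shows "wp plan_prog s (\<lambda>time s'. time \<le> 3 + n * 11 \<and>
    (\<forall>i<n. narr s' ''plan'' (narr s ''inv'' (Suc i)) =
      (if ds i = 0 then 0
       else narr s ''sensor'' (narr s ''start'' (ds i - 1) + rank i (ds i)) + 1)))"
  unfolding plan_prog_def wp_Seq wp_NAssign
proof (rule wp_While[where N = n and T = 10 and I = "\<lambda>j u. nvar u ''i'' = j \<and>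
    nvar u ''q'' = qs j \<and> nvar u ''off'' = (n - j) * M \<and>
    (\<forall>d. d \<noteq> 0 \<longrightarrow> 0 < m d \<longrightarrow> narr u ''ptr'' d = rank j d) \<and>
    (\<forall>i<j. narr u ''plan'' (narr s ''inv'' (Suc i)) =
      (if ds i = 0 then 0
       else narr s ''sensor'' (narr s ''start'' (ds i - 1) + rank i (ds i)) + 1)) \<and>
    (\<forall>i. j \<le> i \<longrightarrow> i < n \<longrightarrow> narr u ''plan'' (narr s ''inv'' (Suc i)) = 0)"], goal_cases)
  case 1
  then show ?case using vars zero qs0 by (simp add: rank_def)
next
  case (2 j u)
  note fr = vars frame_nvar[OF 2(3)] frame_narr[OF 2(3)]
  have scal: "nvar u ''i'' = j" "nvar u ''q'' = qs j" "nvar u ''off'' = (n - j) * M"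
    using 2(2) by blast+
  have ptr: "narr u ''ptr'' d = rank j d" if "d \<noteq> 0" "0 < m d" for d using 2(2) that by blast
  have plan: "narr u ''plan'' (narr s ''inv'' (Suc i)) =
      (if ds i = 0 then 0
       else narr s ''sensor'' (narr s ''start'' (ds i - 1) + rank i (ds i)) + 1)" if "i < j" for i
    using 2(2) that by blast
  have plan0: "narr u ''plan'' (narr s ''inv'' (Suc i)) = 0" if "j \<le> i" "i < n" for i
    using 2(2) that by blast
  have off: "(n - j) * M - M = (n - Suc j) * M"
    by (metis Suc_diff_Suc 2(1) diff_mult_distrib diff_Suc_eq_diff_pred mult_1 diff_diff_left plus_1_eq_Suc add.commute)
  have neq: "narr s ''inv'' (Suc i) \<noteq> narr s ''inv'' (Suc j)" if "i < j" for i
    using inj[OF that 2(1)] .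
  have neq': "narr s ''inv'' (Suc i) \<noteq> narr s ''inv'' (Suc j)" if "Suc j \<le> i" "i < n" for i
    using inj[of j i] that by (simp add: less_eq_Suc_le)
  have rank: "rank (Suc j) d = (if ds j = d then (if rank j d + 1 < m d then rank j d + 1 else 0)
      else rank j d)" if "0 < m d" for d
    unfolding rank_def card_less_Suc_eq using Suc_mod_wrap[OF that] by simp
  show ?case
  proof (cases "ds j = 0")
    case True
    then have "rank (Suc j) d = rank j d" if "d \<noteq> 0" "0 < m d" for d
      using rank that by simp
    then show ?thesis using True 2(1) qs[OF 2(1)] ds[OF 2(1)]
      by (simp add: fr scal off ptr plan plan0 less_Suc_eq all_conj_distrib)
  next
    case False
    note sz = pos[OF 2(1) False]
    have norm: "j + 1 = Suc j" "narr s ''start'' (ds j) - narr s ''start'' (ds j - 1) = m (ds j)"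
      by (simp_all add: m_def)
    show ?thesis using False 2(1) qs[OF 2(1)] ds[OF 2(1), symmetric]
      by (simp add: fr scal off ptr plan plan0 neq neq' rank sz norm less_Suc_eq all_conj_distrib)
  qed
next
  case (3 u)
  then show ?case using vars by (simp add: frame_nvar[OF 3(2)])
next
  case (4 time u)
  then show ?case by simp
qed

section \<open>Windows of types and dynamic programming\<close>

lemma distinct_concat_nth: "distinct (concat gs) \<Longrightarrow> a < length gs \<Longrightarrow> distinct (gs ! a)"
  by (simp add: distinct_concat_iff)

lemma window_digit_count:
  fixes B \<tau> :: nat and qs ds :: "nat \<Rightarrow> nat"
  assumes B: "2 \<le> B" and c: "c \<noteq> 0" and qs0: "qs 0 = 0"
    and qs: "\<And>i. i < n \<Longrightarrow> qs (Suc i) = (qs i * B + ds i) mod B ^ \<tau>"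
    and ds: "\<And>i. i < n \<Longrightarrow> ds i < B"
    and "i \<le> n" "m \<le> \<tau>"
  shows "digit_count B c (qs i mod B ^ m) = card {j. j < i \<and> i \<le> j + m \<and> ds j = c}"
  using assms(6,7)
proof (induction i arbitrary: m)
  case 0
  then show ?case by (simp add: qs0)
next
  case (Suc i)
  show ?case
  proof (cases m)
    case 0
    then show ?thesis by (simp add: card_eq_0_iff)
  next
    case (Suc m')
    have "qs (Suc i) mod B ^ m = (qs i * B + ds i) mod B ^ m"
      using qs[of i] Suc.prems by (simp add: mod_mod_cancel le_imp_power_dvd)
    also have "\<dots> = (qs i mod B ^ m') * B + ds i"
    proof -
      have "(qs i * B + ds i) mod (B * B ^ m') =
          B * ((qs i * B + ds i) div B mod B ^ m') + (qs i * B + ds i) mod B"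
        by (rule mod_mult2_eq)
      then show ?thesis using ds[of i] Suc.prems B by (simp add: Suc mult.commute)
    qed
    finally have "digit_count B c (qs (Suc i) mod B ^ m) =
        of_bool (ds i = c) + card {j. j < i \<and> i \<le> j + m' \<and> ds j = c}"
      using Suc.IH[of m'] Suc.prems ds[of i] by (simp add: digit_count_append B c Suc)
    moreover have "{j. j < Suc i \<and> Suc i \<le> j + m \<and> ds j = c} =
        (if ds i = c then insert i {j. j < i \<and> i \<le> j + m' \<and> ds j = c}
         else {j. j < i \<and> i \<le> j + m' \<and> ds j = c})"
      by (auto simp: less_Suc_eq Suc)
    ultimately show ?thesis by simp
  qed
qed

lemma rank_gap:
  fixes ds :: "nat \<Rightarrow> nat"
  assumes "i < j" "ds i = d" "ds j = d"
    and "card {l. l < j \<and> j \<le> l + \<tau> \<and> ds l = d} < m"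
    and eq: "card {l. l < i \<and> ds l = d} mod m = card {l. l < j \<and> ds l = d} mod m"
  shows "i + \<tau> < j"
proof (rule ccontr)
  assume close: "\<not> i + \<tau> < j"
  define A where "A = {l. l < i \<and> ds l = d}"
  define W where "W = {l. i \<le> l \<and> l < j \<and> ds l = d}"
  have "{l. l < j \<and> ds l = d} = A \<union> W" "A \<inter> W = {}"
    using assms(1) by (auto simp: A_def W_def)
  moreover have fin: "finite A" "finite W" by (simp_all add: A_def W_def)
  ultimately have "card {l. l < j \<and> ds l = d} = card A + card W"
    using card_Un_disjoint by metis
  with eq have "card A mod m = (card A + card W) mod m" by (simp add: A_def)
  then have "m dvd card W" by (metis add_diff_cancel_left' le_add1 mod_eq_dvd_iff_nat)
  moreover have "i \<in> W" using assms(1,2) by (simp add: W_def)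
  then have "0 < card W" using fin by (auto simp: card_gt_0_iff)
  moreover have "card W \<le> card {l. l < j \<and> j \<le> l + \<tau> \<and> ds l = d}"
    using close by (intro card_mono) (auto simp: W_def)
  ultimately show False using assms(4) by (auto dest: dvd_imp_le)
qed

lemma dp_upper:
  fixes V :: "nat \<Rightarrow> nat \<Rightarrow> real"
  assumes V0: "\<And>q. q < M \<Longrightarrow> V 0 q = 0" and M: "0 < M"
    and best: "\<And>l q. l < n \<Longrightarrow> q < M \<Longrightarrow>
      is_best (\<lambda>d. V l ((q * B + d) mod M) + g (n - Suc l) d) (ok (n - Suc l) q) B (cd l q) (V (Suc l) q)"
    and qs0: "qs 0 = 0"
    and qs: "\<And>i. i < n \<Longrightarrow> qs (Suc i) = (qs i * B + ds i) mod M"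
    and ds: "\<And>i. i < n \<Longrightarrow> ds i < B \<and> ok i (qs i) (ds i)"
  shows "(\<Sum>i<n. g i (ds i)) \<le> V n 0"
proof -
  have "(\<Sum>j<i. g j (ds j)) + V (n - i) (qs i) \<le> V n 0 \<and> qs i < M" if "i \<le> n" for i
    using that
  proof (induction i)
    case 0
    then show ?case by (simp add: qs0 M)
  next
    case (Suc i)
    have l: "n - Suc i < n" "Suc (n - Suc i) = n - i" "n - (n - i) = i"
      using Suc.prems by simp_all
    have lt: "qs i < M" and IH: "(\<Sum>j<i. g j (ds j)) + V (n - i) (qs i) \<le> V n 0"
      using Suc by simp_all
    have i: "i < n" using Suc.prems by simp
    have "ok i (qs i) d \<Longrightarrow> d < B \<Longrightarrow>
        V (n - Suc i) ((qs i * B + d) mod M) + g i d \<le> V (n - i) (qs i)" for d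
      using best[OF l(1) lt] unfolding l is_best_def by blast
    from this[of "ds i"] have "V (n - Suc i) (qs (Suc i)) + g i (ds i) \<le> V (n - i) (qs i)"
      using ds[OF i] unfolding qs[OF i] by blast
    moreover have "qs (Suc i) < M" using M by (simp add: qs[OF i])
    ultimately show ?case using IH by simp
  qed
  from this[of n] show ?thesis using V0[of "qs n"] by simp
qed

lemma dp_attained:
  fixes V :: "nat \<Rightarrow> nat \<Rightarrow> real"
  assumes V0: "\<And>q. q < M \<Longrightarrow> V 0 q = 0" and M: "0 < M"
    and best: "\<And>l q. l < n \<Longrightarrow> q < M \<Longrightarrow>
      is_best (\<lambda>d. V l ((q * B + d) mod M) + g (n - Suc l) d) (ok (n - Suc l) q) B (cd l q) (V (Suc l) q)"
    and qs0: "qs 0 = 0"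
    and qs: "\<And>i. i < n \<Longrightarrow> qs (Suc i) = (qs i * B + ds i) mod M"
    and ds: "\<And>i. i < n \<Longrightarrow> ds i = cd (n - Suc i) (qs i)"
  shows "(\<Sum>i<n. g i (ds i)) = V n 0"
    and "\<And>i. i < n \<Longrightarrow> ds i < B \<and> ok i (qs i) (ds i)"
proof -
  have l: "n - Suc i < n" "n - Suc (n - Suc i) = i" "Suc (n - Suc i) = n - i" if "i < n" for i
    using that by simp_all
  have lt: "qs i < M" if "i \<le> n" for i
    using that qs M by (cases i) (simp_all add: qs0)
  have bst: "is_best (\<lambda>d. V (n - Suc i) ((qs i * B + d) mod M) + g i d) (ok i (qs i)) B
      (ds i) (V (n - i) (qs i))" if "i < n" for i
    using best[OF l(1)[OF that], of "qs i"] lt[of i] ds[OF that] l[OF that] that by simp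
  show "ds i < B \<and> ok i (qs i) (ds i)" if "i < n" for i
    using bst[OF that] by (simp add: is_best_def)
  have "(\<Sum>j<i. g j (ds j)) + V (n - i) (qs i) = V n 0" if "i \<le> n" for i
    using that
  proof (induction i)
    case 0
    then show ?case by (simp add: qs0)
  next
    case (Suc i)
    then show ?case using bst[of i] qs[of i] by (simp add: is_best_def)
  qed
  from this[of n] show "(\<Sum>i<n. g i (ds i)) = V n 0" using V0 lt by simp
qed

lemma wpE:
  assumes "wp c s Q"
  obtains t s' where "exec c s t s'" "Q t s'" "frame c s s'"
  using assms exec_frame unfolding wp_def by blast

lemma is_best_cong:
  "(\<And>d. d < m \<Longrightarrow> f d = f' d) \<Longrightarrow> (\<And>d. d < m \<Longrightarrow> ok d = ok' d) \<Longrightarrow>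
    is_best f ok m d x \<longleftrightarrow> is_best f' ok' m d x"
  by (auto simp: is_best_def)

lemma time_bound:
  fixes n B M \<tau> :: nat
  assumes "1 \<le> n" "2 \<le> B" "M = B ^ \<tau>"
    and "t1 \<le> 4 + \<tau> * (3 * B + 6)" "t2 \<le> 3 + n * 5" "t3 \<le> 5 + M * (5 * B + 8)"
      "t4 \<le> 3 + n * (9 + M * (10 * B + 11))" "t5 \<le> 3 + n * 11"
  shows "1 + (t1 + (t2 + (t3 + (t4 + t5)))) \<le> 100 * (n * B ^ (\<tau> + 2))"
proof -
  have "\<tau> < 2 ^ \<tau>" by (rule less_exp)
  also have "2 ^ \<tau> \<le> M" using assms(2,3) by (simp add: power_mono)
  finally have \<tau>: "\<tau> \<le> M" by simp
  have M: "1 \<le> M" using assms(2,3) by simp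
  define X where "X = n * (M * (B * B))"
  have B: "1 \<le> B" "B \<le> B * B" using assms(2) by simp_all
  then have "1 \<le> B * B" by linarith
  have *: "m * (k * l) \<le> X" if "m \<le> n" "k \<le> M" "l \<le> B * B" for m k l
    unfolding X_def using that by (intro mult_le_mono)
  have "\<tau> * B \<le> X" "\<tau> \<le> X" "n \<le> X" "M * B \<le> X" "M \<le> X" "n * (M * B) \<le> X" "n * M \<le> X" "1 \<le> X"
    using \<open>1 \<le> B * B\<close> *[of 1 \<tau> B] *[of 1 \<tau> 1] *[of n 1 1] *[of 1 M B] *[of 1 M 1] *[of n M B] *[of n M 1]
      *[of 1 1 1] assms(1) \<tau> M B by simp_all
  moreover have "t1 \<le> 4 + 3 * (\<tau> * B) + 6 * \<tau>" "t3 \<le> 5 + 5 * (M * B) + 8 * M"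
    "t4 \<le> 3 + 9 * n + 10 * (n * (M * B)) + 11 * (n * M)"
    using assms(4,6,7) by (simp_all add: algebra_simps)
  ultimately have "1 + (t1 + (t2 + (t3 + (t4 + t5)))) \<le> 100 * X"
    using assms(5,8) by linarith
  then show ?thesis by (simp add: X_def assms(3) mult_ac)
qed


section \<open>Sensing plans and sequences of types\<close>

locale red_instance =
  fixes E :: esg and \<sigma> :: "nat \<Rightarrow> nat" and \<tau> :: nat and gs :: "nat list list"
  assumes recharge: "recharge E = enat \<tau>"
    and ordering: "target_ordering E \<sigma>"
    and partition: "type_partition E gs"
begin

abbreviation n :: nat where "n \<equiv> num_targets E"
abbreviation K :: nat where "K \<equiv> length gs"

definition tgt :: "nat \<Rightarrow> nat" where
  "tgt p = inv_into (targets E) \<sigma> p"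

definition cls :: "nat \<Rightarrow> nat list" where
  "cls d = gs ! (d - 1)"

definition capable :: "nat \<Rightarrow> nat \<Rightarrow> bool" where
  "capable t d \<longleftrightarrow> senses E t (hd (cls d))"

definition gain :: "nat \<Rightarrow> nat \<Rightarrow> real" where
  "gain i d = (if d = 0 then 0 else target_value E (tgt (Suc i)))"

definition feasible :: "(nat \<Rightarrow> nat) \<Rightarrow> bool" where
  "feasible ds \<longleftrightarrow> (\<forall>i<n. ds i \<le> K \<and> (ds i \<noteq> 0 \<longrightarrow>
     card {j. j < i \<and> i \<le> j + \<tau> \<and> ds j = ds i} < length (cls (ds i)) \<and>
     capable (tgt (Suc i)) (ds i)))"

lemma inj_sigma: "inj_on \<sigma> {..<n}"
  and sigma_image: "\<sigma> ` {..<n} = {1..n}"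
  using ordering by (auto simp: target_ordering_def bij_betw_def)

lemma tgt_sigma: "t < n \<Longrightarrow> tgt (\<sigma> t) = t"
  by (simp add: tgt_def inv_into_f_f inj_sigma)

lemma sigma_tgt: "i < n \<Longrightarrow> \<sigma> (tgt (Suc i)) = Suc i"
  and tgt_less: "i < n \<Longrightarrow> tgt (Suc i) < n"
proof -
  assume "i < n"
  then have "Suc i \<in> \<sigma> ` {..<n}" by (simp add: sigma_image)
  from f_inv_into_f[OF this] inv_into_into[OF this]
  show "\<sigma> (tgt (Suc i)) = Suc i" "tgt (Suc i) < n" by (simp_all add: tgt_def)
qed

lemma targetE:
  assumes "t < n"
  obtains i where "i < n" "t = tgt (Suc i)" "\<sigma> t = Suc i"
proof -
  have "\<sigma> t \<in> {1..n}" using sigma_image assms by blast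
  then obtain i where "\<sigma> t = Suc i" "i < n" by (cases "\<sigma> t") auto
  then show ?thesis using that tgt_sigma[OF assms] by metis
qed

lemma bij_tgt: "bij_betw (\<lambda>i. tgt (Suc i)) {..<n} (targets E)"
proof (rule bij_betwI')
  fix x y assume "x \<in> {..<n}" "y \<in> {..<n}"
  then show "(tgt (Suc x) = tgt (Suc y)) = (x = y)"
    using sigma_tgt by (metis lessThan_iff nat.inject)
next
  fix t assume "t \<in> targets E"
  then show "\<exists>i\<in>{..<n}. t = tgt (Suc i)" using targetE by (metis lessThan_iff)
qed (simp add: tgt_less)

lemma cls_nonempty: "d \<noteq> 0 \<Longrightarrow> d \<le> K \<Longrightarrow> cls d \<noteq> []"
  using partition by (auto simp: type_partition_def cls_def in_set_conv_nth)

lemma cls_distinct: "d \<noteq> 0 \<Longrightarrow> d \<le> K \<Longrightarrow> distinct (cls d)"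
  using partition unfolding cls_def type_partition_def
  by (intro distinct_concat_nth) auto

lemma cls_sensors: "d \<noteq> 0 \<Longrightarrow> d \<le> K \<Longrightarrow> s \<in> set (cls d) \<Longrightarrow> s \<in> sensors E"
proof -
  assume "d \<noteq> 0" "d \<le> K" "s \<in> set (cls d)"
  then have "s \<in> set (concat gs)" unfolding cls_def set_concat
    by (metis UN_I nth_mem Suc_pred' bot_nat_0.not_eq_extremum less_eq_Suc_le)
  then show ?thesis using partition by (auto simp: type_partition_def)
qed

lemma cls_column:
  assumes "d \<noteq> 0" "d \<le> K" "d' \<noteq> 0" "d' \<le> K" "s \<in> set (cls d)" "s' \<in> set (cls d')"
  shows "column E s = column E s' \<longleftrightarrow> d = d'"
proof -
  have "d - 1 < K" "d' - 1 < K" "d - 1 = d' - 1 \<longleftrightarrow> d = d'" using assms(1-4) by auto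
  then show ?thesis using partition assms(5,6) unfolding type_partition_def cls_def by metis
qed

lemma cls_senses:
  assumes "d \<noteq> 0" "d \<le> K" "s \<in> set (cls d)" "t < n"
  shows "senses E t s \<longleftrightarrow> capable t d"
proof -
  have "hd (cls d) \<in> set (cls d)" using cls_nonempty assms(1,2) by simp
  then have "column E s = column E (hd (cls d))" using cls_column assms by blast
  then have "column E s ! t = column E (hd (cls d)) ! t" by simp
  then show ?thesis using assms(4) by (simp add: column_def capable_def)
qed

lemma sensor_cls:
  assumes "s \<in> sensors E"
  shows "\<exists>d. d \<noteq> 0 \<and> d \<le> K \<and> s \<in> set (cls d)"
proof -
  have "s \<in> set (concat gs)" using assms partition by (auto simp: type_partition_def)
  then obtain xs where "xs \<in> set gs" "s \<in> set xs" by auto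
  then obtain a where "a < K" "s \<in> set (gs ! a)" by (metis in_set_conv_nth)
  then show ?thesis by (intro exI[of _ "Suc a"]) (simp add: cls_def)
qed

lemma num_types_eq: "num_types E = K"
proof -
  have "column E ` sensors E = (\<lambda>d. column E (hd (cls d))) ` {1..K}" (is "?L = ?R")
  proof
    show "?L \<subseteq> ?R"
    proof
      fix c assume "c \<in> ?L"
      then obtain s where s: "s \<in> sensors E" "c = column E s" by blast
      then obtain d where d: "d \<noteq> 0" "d \<le> K" "s \<in> set (cls d)" using sensor_cls by blast
      then have "c = column E (hd (cls d))"
        using s cls_column[OF d(1,2) d(1,2) d(3) hd_in_set] cls_nonempty by blast
      then show "c \<in> ?R" using d by auto
    qed
    show "?R \<subseteq> ?L"
    proof
      fix c assume "c \<in> ?R"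
      then obtain d where "d \<in> {1..K}" and c: "c = column E (hd (cls d))" by blast
      then have d: "d \<noteq> 0" "d \<le> K" by auto
      then have "hd (cls d) \<in> sensors E"
        by (intro cls_sensors[of d] hd_in_set cls_nonempty)
      then show "c \<in> ?L" using c by blast
    qed
  qed
  moreover have "inj_on (\<lambda>d. column E (hd (cls d))) {1..K}"
  proof (rule inj_onI)
    fix d d' assume "d \<in> {1..K}" "d' \<in> {1..K}" and eq: "column E (hd (cls d)) = column E (hd (cls d'))"
    then have d: "d \<noteq> 0" "d \<le> K" "d' \<noteq> 0" "d' \<le> K" by auto
    show "d = d'"
      using cls_column[OF d hd_in_set hd_in_set] cls_nonempty d eq by blast
  qed
  ultimately show ?thesis by (simp add: num_types_def card_image)
qed

lemma unsensed_value_eq: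
  assumes "\<And>i. i < n \<Longrightarrow> tgt (Suc i) \<in> (\<Union>s\<in>sensors E. \<psi> s) \<longleftrightarrow> ds i \<noteq> 0"
  shows "unsensed_value E \<psi> = sum (target_value E) (targets E) - (\<Sum>i<n. gain i (ds i))"
proof -
  let ?U = "\<Union>s\<in>sensors E. \<psi> s"
  have "unsensed_value E \<psi> = (\<Sum>t\<in>targets E. if t \<in> ?U then 0 else target_value E t)"
    unfolding unsensed_value_def by (intro sum.mono_neutral_cong_left) auto
  also have "\<dots> = (\<Sum>i<n. if tgt (Suc i) \<in> ?U then 0 else target_value E (tgt (Suc i)))"
    by (rule sum.reindex_bij_betw[OF bij_tgt, symmetric])
  also have "\<dots> = (\<Sum>i<n. target_value E (tgt (Suc i)) - gain i (ds i))"
    by (intro sum.cong refl) (use assms in \<open>auto simp: gain_def\<close>)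
  also have "\<dots> = (\<Sum>i<n. target_value E (tgt (Suc i))) - (\<Sum>i<n. gain i (ds i))"
    by (rule sum_subtractf)
  also have "(\<Sum>i<n. target_value E (tgt (Suc i))) = sum (target_value E) (targets E)"
    by (rule sum.reindex_bij_betw[OF bij_tgt])
  finally show ?thesis .
qed

text \<open>Assigning the sensors of a type in turn uses a sensor again only after all sensors of its
  type were used, so the bound on the number of uses in a window makes the plan valid.\<close>

lemma round_robin_plan:
  assumes feas: "feasible ds"
    and plan: "\<And>i. i < n \<Longrightarrow> pl (tgt (Suc i)) = (if ds i = 0 then 0 else
      cls (ds i) ! (card {j. j < i \<and> ds j = ds i} mod length (cls (ds i))) + 1)"
    and \<psi>: "\<And>s. \<psi> s = {t \<in> targets E. pl t = s + 1}"
  shows "valid_plan E \<sigma> \<psi>"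
    and "unsensed_value E \<psi> = sum (target_value E) (targets E) - (\<Sum>i<n. gain i (ds i))"
proof -
  define r where "r = (\<lambda>i. card {j. j < i \<and> ds j = ds i} mod length (cls (ds i)))"
  have ds: "ds i \<le> K" if "i < n" for i using feas that by (simp add: feasible_def)
  have r_less: "r i < length (cls (ds i))" if "i < n" "ds i \<noteq> 0" for i
    using cls_nonempty[OF that(2) ds[OF that(1)]] by (simp add: r_def)
  have used: "ds i \<noteq> 0 \<and> s = cls (ds i) ! r i \<and> s \<in> set (cls (ds i))"
    if "i < n" "tgt (Suc i) \<in> \<psi> s" for i s
  proof -
    have nz: "ds i \<noteq> 0" and "s = cls (ds i) ! r i"
      using that plan[of i] by (auto simp: \<psi> r_def split: if_splits)
    then show ?thesis using r_less[OF that(1) nz] by simp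
  qed
  have gap: "i + \<tau> < j" if ij: "i < j" "j < n" "tgt (Suc i) \<in> \<psi> s" "tgt (Suc j) \<in> \<psi> s" for i j s
  proof -
    have "i < n" using ij by simp
    note ui = used[OF \<open>i < n\<close> ij(3)] and uj = used[OF ij(2,4)]
    have same: "ds i = ds j" using ui uj cls_column ds \<open>i < n\<close> ij(2) by blast
    have "distinct (cls (ds j))" using cls_distinct uj ds ij(2) by blast
    then have "r i = r j"
      using ui uj same r_less[of i] r_less[of j] \<open>i < n\<close> ij(2) nth_eq_iff_index_eq by metis
    moreover have "card {l. l < j \<and> j \<le> l + \<tau> \<and> ds l = ds j} < length (cls (ds j))"
      using feas ij(2) uj by (simp add: feasible_def)
    ultimately show ?thesis
      using rank_gap[of i j ds "ds j" \<tau> "length (cls (ds j))"] ij(1) same by (simp add: r_def)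
  qed
  show "valid_plan E \<sigma> \<psi>"
    unfolding valid_plan_def
  proof (intro conjI ballI impI)
    show "sensing_plan E \<psi>" by (auto simp: sensing_plan_def \<psi>)
  next
    fix s t assume "t \<in> \<psi> s"
    moreover from this have "t < n" by (simp add: \<psi>)
    ultimately obtain i where i: "i < n" "t = tgt (Suc i)" "tgt (Suc i) \<in> \<psi> s"
      using targetE by metis
    then have "capable t (ds i)" using feas used[OF i(1,3)] by (auto simp: feasible_def)
    then show "senses E t s" using cls_senses used[OF i(1,3)] ds[OF i(1)] \<open>t < n\<close> by blast
  next
    fix s t t' assume t: "t \<in> \<psi> s" "t' \<in> \<psi> s" "t \<noteq> t'"
    then have "t < n" "t' < n" by (simp_all add: \<psi>)
    obtain i where i: "i < n" "t = tgt (Suc i)" "\<sigma> t = Suc i" using targetE[OF \<open>t < n\<close>] .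
    obtain j where j: "j < n" "t' = tgt (Suc j)" "\<sigma> t' = Suc j" using targetE[OF \<open>t' < n\<close>] .
    have "i + \<tau> < j \<or> j + \<tau> < i"
      using gap[of i j s] gap[of j i s] i j t by (metis linorder_neqE_nat)
    then show "recharge E < enat (nat \<bar>int (\<sigma> t) - int (\<sigma> t')\<bar>)"
      using i j by (auto simp: recharge)
  qed
  have "tgt (Suc i) \<in> (\<Union>s\<in>sensors E. \<psi> s) \<longleftrightarrow> ds i \<noteq> 0" if i: "i < n" for i
  proof
    assume "tgt (Suc i) \<in> (\<Union>s\<in>sensors E. \<psi> s)"
    then show "ds i \<noteq> 0" using used[OF i] by blast
  next
    assume nz: "ds i \<noteq> 0"
    then have "cls (ds i) ! r i \<in> sensors E"
      using cls_sensors[OF nz ds[OF i]] r_less[OF i nz] by simp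
    moreover have "tgt (Suc i) \<in> \<psi> (cls (ds i) ! r i)"
      using plan[OF i] nz tgt_less[OF i] by (simp add: \<psi> r_def)
    ultimately show "tgt (Suc i) \<in> (\<Union>s\<in>sensors E. \<psi> s)" by blast
  qed
  then show "unsensed_value E \<psi> = sum (target_value E) (targets E) - (\<Sum>i<n. gain i (ds i))"
    by (rule unsensed_value_eq)
qed

lemma valid_plan_types:
  assumes "valid_plan E \<sigma> \<psi>"
  obtains ds where "feasible ds"
    "unsensed_value E \<psi> = sum (target_value E) (targets E) - (\<Sum>i<n. gain i (ds i))"
proof -
  let ?U = "\<Union>s\<in>sensors E. \<psi> s"
  define sen where "sen = (\<lambda>i. SOME s. s \<in> sensors E \<and> tgt (Suc i) \<in> \<psi> s)"
  define kind where "kind = (\<lambda>s. SOME d. d \<noteq> 0 \<and> d \<le> K \<and> s \<in> set (cls d))"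
  define ds where "ds = (\<lambda>i. if tgt (Suc i) \<in> ?U then kind (sen i) else 0)"
  have sen: "sen i \<in> sensors E \<and> tgt (Suc i) \<in> \<psi> (sen i)" if "tgt (Suc i) \<in> ?U" for i
    unfolding sen_def by (rule someI_ex) (use that in blast)
  have kind: "kind s \<noteq> 0 \<and> kind s \<le> K \<and> s \<in> set (cls (kind s))" if "s \<in> sensors E" for s
    unfolding kind_def by (rule someI_ex) (rule sensor_cls[OF that])
  have nz: "tgt (Suc i) \<in> ?U \<longleftrightarrow> ds i \<noteq> 0" for i
  proof (cases "tgt (Suc i) \<in> ?U")
    case True
    then show ?thesis using kind[of "sen i"] sen[OF True] unfolding ds_def by simp
  next
    case False
    then show ?thesis unfolding ds_def by simp
  qed
  have used: "sen i \<in> sensors E" "tgt (Suc i) \<in> \<psi> (sen i)" "sen i \<in> set (cls (ds i))" "ds i \<le> K"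
    if "ds i \<noteq> 0" for i
  proof -
    have U: "tgt (Suc i) \<in> ?U" using that nz by blast
    then have "ds i = kind (sen i)" unfolding ds_def by (rule if_P)
    then show "sen i \<in> sensors E" "tgt (Suc i) \<in> \<psi> (sen i)" "sen i \<in> set (cls (ds i))" "ds i \<le> K"
      using sen[OF U] kind[of "sen i"] by simp_all
  qed
  have "feasible ds"
    unfolding feasible_def
  proof (intro allI impI conjI)
    fix i assume i: "i < n"
    show "ds i \<le> K" using used(4)[of i] by (cases "ds i = 0") simp_all
    assume d: "ds i \<noteq> 0"
    have "senses E (tgt (Suc i)) (sen i)" using assms used[OF d] by (simp add: valid_plan_def)
    then show "capable (tgt (Suc i)) (ds i)" using cls_senses used[OF d] d tgt_less[OF i] by blast
    let ?W = "{j. j < i \<and> i \<le> j + \<tau> \<and> ds j = ds i}"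
    have "inj_on sen (insert i ?W)"
    proof (rule inj_onI, rule ccontr)
      fix j l assume jl: "j \<in> insert i ?W" "l \<in> insert i ?W" "sen j = sen l" "j \<noteq> l"
      then have "ds j \<noteq> 0" "ds l \<noteq> 0" "j < n" "l < n" using d i by auto
      note uj = used[OF \<open>ds j \<noteq> 0\<close>] and ul = used[OF \<open>ds l \<noteq> 0\<close>]
      have "tgt (Suc j) \<noteq> tgt (Suc l)"
        using sigma_tgt[OF \<open>j < n\<close>] sigma_tgt[OF \<open>l < n\<close>] jl(4) by auto
      then have "recharge E < enat (nat \<bar>int (\<sigma> (tgt (Suc j))) - int (\<sigma> (tgt (Suc l)))\<bar>)"
        using assms uj ul jl(3) unfolding valid_plan_def by metis
      then show False
        using jl by (auto simp: recharge sigma_tgt \<open>j < n\<close> \<open>l < n\<close>)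
    qed
    moreover have "sen ` insert i ?W \<subseteq> set (cls (ds i))"
    proof
      fix s assume "s \<in> sen ` insert i ?W"
      then obtain j where "s = sen j" "ds j = ds i" by auto
      then show "s \<in> set (cls (ds i))" using used(3)[of j] d by simp
    qed
    ultimately have "card (insert i ?W) \<le> card (set (cls (ds i)))"
      by (intro card_inj_on_le) auto
    then show "card ?W < length (cls (ds i))"
      using card_length[of "cls (ds i)"] by simp
  qed
  then show ?thesis using that unsensed_value_eq[OF nz] by blast
qed


definition ok :: "nat \<Rightarrow> nat \<Rightarrow> nat \<Rightarrow> bool" where
  "ok i q d \<longleftrightarrow> d = 0 \<or> digit_count (K + 1) d q < length (cls d) \<and> capable (tgt (Suc i)) d"

lemma feasible_iff_ok:
  assumes "K \<noteq> 0" and qs0: "qs 0 = 0"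
    and qs: "\<And>i. i < n \<Longrightarrow> qs (Suc i) = (qs i * (K + 1) + ds i) mod (K + 1) ^ \<tau>"
    and ds: "\<And>i. i < n \<Longrightarrow> ds i < K + 1"
  shows "feasible ds \<longleftrightarrow> (\<forall>i<n. ok i (qs i) (ds i))"
proof -
  have "digit_count (K + 1) (ds i) (qs i) = card {j. j < i \<and> i \<le> j + \<tau> \<and> ds j = ds i}"
    if "i < n" "ds i \<noteq> 0" for i
  proof -
    have "qs i < (K + 1) ^ \<tau>" using that qs qs0 by (cases i) simp_all
    then show ?thesis
      using window_digit_count[of "K + 1" "ds i" qs n ds \<tau> i \<tau>] assms that by simp
  qed
  then show ?thesis using ds by (auto simp: feasible_def ok_def less_Suc_eq_le Suc_eq_plus1[symmetric])
qed

lemma nth_concat_cls: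
  assumes "d \<noteq> 0" "d \<le> K"
  shows "length (concat (take d gs)) = length (concat (take (d - 1) gs)) + length (cls d)"
    and "x < length (cls d) \<Longrightarrow> length (concat (take (d - 1) gs)) + x < length (concat gs) \<and>
      concat gs ! (length (concat (take (d - 1) gs)) + x) = cls d ! x"
proof -
  have d: "d - 1 < K" "Suc (d - 1) = d" using assms by simp_all
  show "length (concat (take d gs)) = length (concat (take (d - 1) gs)) + length (cls d)"
    using take_Suc_conv_app_nth[OF d(1)] unfolding d by (simp add: cls_def)
  have "concat gs = concat (take (d - 1) gs) @ cls d @ concat (drop d gs)"
    using arg_cong[OF id_take_nth_drop[OF d(1)], of concat] unfolding d by (simp add: cls_def)
  then show "length (concat (take (d - 1) gs)) + x < length (concat gs) \<and>
      concat gs ! (length (concat (take (d - 1) gs)) + x) = cls d ! x" if "x < length (cls d)"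
    using that by (simp add: nth_append)
qed

lemma best_red_responseI:
  assumes "feasible ds"
    and "\<And>i. i < n \<Longrightarrow> pl (tgt (Suc i)) = (if ds i = 0 then 0 else
      cls (ds i) ! (card {j. j < i \<and> ds j = ds i} mod length (cls (ds i))) + 1)"
    and "\<And>s. \<psi> s = {t \<in> targets E. pl t = s + 1}"
    and "\<And>ds'. feasible ds' \<Longrightarrow> (\<Sum>i<n. gain i (ds' i)) \<le> (\<Sum>i<n. gain i (ds i))"
  shows "best_red_response E \<sigma> \<psi>"
proof -
  have "\<not> unsensed_value E \<phi> < unsensed_value E \<psi>"
    if valid: "valid_plan E \<sigma> \<phi>" for \<phi>
  proof -
    obtain ds' where "feasible ds'"
      "unsensed_value E \<phi> = sum (target_value E) (targets E) - (\<Sum>i<n. gain i (ds' i))"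
      by (rule valid_plan_types[OF valid])
    then show ?thesis using assms(4)[of ds'] round_robin_plan(2)[OF assms(1-3)] by linarith
  qed
  then show ?thesis
    using round_robin_plan(1)[OF assms(1-3)] by (auto simp: best_red_response_def is_arg_min_def)
qed

lemma exec_no_types:
  assumes "K = 0"
  shows "exec red_response_prog (input_store E \<sigma> gs) 2 (input_store E \<sigma> gs)"
    and "best_red_response E \<sigma> (output_plan E (input_store E \<sigma> gs))"
proof -
  have "exec red_response_prog (input_store E \<sigma> gs) (1 + 1) (input_store E \<sigma> gs)"
    unfolding red_response_prog_def
    by (rule exec.IfFalse[OF _ exec.Skip]) (simp add: input_store_def assms)
  then show "exec red_response_prog (input_store E \<sigma> gs) 2 (input_store E \<sigma> gs)"
    by (simp only: one_add_one)
  show "best_red_response E \<sigma> (output_plan E (input_store E \<sigma> gs))"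
    by (rule best_red_responseI[of "\<lambda>_. 0" "\<lambda>_. 0"])
      (auto simp: feasible_def output_plan_def input_store_def assms gain_def)
qed


section \<open>Correctness and running time\<close>

lemma input_store_simps:
  fixes k :: nat
  defines "k \<equiv> num_sensors E" and "s0 \<equiv> input_store E \<sigma> gs"
  shows "nvar s0 ''n'' = n" "nvar s0 ''k'' = k" "nvar s0 ''tau'' = \<tau>" "nvar s0 ''types'' = K"
    "narr s0 ''cnt'' = (\<lambda>_. 0)" "narr s0 ''plan'' = (\<lambda>_. 0)" "narr s0 ''ptr'' = (\<lambda>_. 0)"
    "rarr s0 ''H'' = (\<lambda>_. 0)"
    "i < n \<Longrightarrow> narr s0 ''sigma'' i = \<sigma> i"
    "p < n * k \<Longrightarrow> narr s0 ''D'' p = of_bool (senses E (p div k) (p mod k))"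
    "c \<le> K \<Longrightarrow> narr s0 ''start'' c = length (concat (take c gs))"
    "p < length (concat gs) \<Longrightarrow> narr s0 ''sensor'' p = concat gs ! p"
    "i < n \<Longrightarrow> rarr s0 ''v'' i = target_value E i"
  by (simp_all add: s0_def k_def input_store_def recharge)

lemma exec_with_types:
  assumes "K \<noteq> 0"
  shows "\<exists>t st. exec red_response_prog (input_store E \<sigma> gs) t st \<and>
    best_red_response E \<sigma> (output_plan E st) \<and>
    (n > 0 \<longrightarrow> t \<le> 100 * (n * (K + 1) ^ (\<tau> + 2)))"
proof -
  define B where "B = K + 1"
  define M where "M = B ^ \<tau>"
  have B: "2 \<le> B" "1 \<le> B" and M: "0 < M" using assms by (simp_all add: B_def M_def) (cases gs, simp_all)
  define s0 where "s0 = input_store E \<sigma> gs"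
  note s0 = input_store_simps[folded s0_def]
  have "wp power_prog s0 (\<lambda>t s'. t \<le> 4 + \<tau> * (3 * B + 6) \<and> nvar s' ''B'' = B \<and> nvar s' ''M'' = M)"
    using wp_power_prog[of s0] unfolding s0 B_def M_def .
  then obtain t1 s1 where e1: "exec power_prog s0 t1 s1" and t1: "t1 \<le> 4 + \<tau> * (3 * B + 6)"
    and s1: "nvar s1 ''B'' = B" "nvar s1 ''M'' = M" and f1: "frame power_prog s0 s1"
    by (elim wpE) blast
  note f1 = frame_nvar[OF f1, unfolded power_prog_def] frame_narr[OF f1, unfolded power_prog_def]
    frame_rarr[OF f1, unfolded power_prog_def]
  have sig: "narr s1 ''sigma'' i = \<sigma> i" if "i < n" for i using that by (simp add: f1 s0)
  have n1: "nvar s1 ''n'' = n" "nvar s1 ''k'' = num_sensors E" by (simp_all add: f1 s0)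
  have inj: "inj_on (narr s1 ''sigma'') {..<n}"
    using inj_sigma by (simp add: inj_on_def sig)
  have "wp index_prog s1 (\<lambda>t s'. t \<le> 3 + n * 5 \<and>
      (\<forall>i<n. narr s' ''inv'' (\<sigma> i) = i \<and> narr s' ''row'' i = i * num_sensors E))"
    by (rule wp_mono[OF wp_index_prog[of s1, unfolded n1, OF inj]]) (simp add: sig)
  then obtain t2 s2 where e2: "exec index_prog s1 t2 s2" and t2: "t2 \<le> 3 + n * 5"
    and s2: "\<forall>i<n. narr s2 ''inv'' (\<sigma> i) = i \<and> narr s2 ''row'' i = i * num_sensors E"
    and f2: "frame index_prog s1 s2"
    by (elim wpE) blast
  note s2 = s2[rule_format]
  note f2 = frame_nvar[OF f2, unfolded index_prog_def] frame_narr[OF f2, unfolded index_prog_def]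
    frame_rarr[OF f2, unfolded index_prog_def]
  have v2: "nvar s2 ''B'' = B" "nvar s2 ''M'' = M" "narr s2 ''cnt'' = (\<lambda>_. 0)"
    using s1 by (simp_all add: f2) (simp add: f1 s0)
  have "wp count_prog s2 (\<lambda>t s'. t \<le> 5 + M * (5 * B + 8) \<and>
      (\<forall>q<M. \<forall>d<B. d \<noteq> 0 \<longrightarrow> narr s' ''cnt'' (q * B + d) = digit_count B d q))"
    using wp_count_prog[of s2] B(1) unfolding v2 by blast
  then obtain t3 s3 where e3: "exec count_prog s2 t3 s3" and t3: "t3 \<le> 5 + M * (5 * B + 8)"
    and s3: "\<forall>q<M. \<forall>d<B. d \<noteq> 0 \<longrightarrow> narr s3 ''cnt'' (q * B + d) = digit_count B d q"
    and f3: "frame count_prog s2 s3"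
    by (elim wpE) blast
  note s3 = s3[rule_format]
  note f3 = frame_nvar[OF f3, unfolded count_prog_def count_inner_def]
    frame_narr[OF f3, unfolded count_prog_def count_inner_def]
    frame_rarr[OF f3, unfolded count_prog_def count_inner_def]
  have inv: "narr s3 ''inv'' (Suc i) = tgt (Suc i)" if "i < n" for i
    using s2[OF tgt_less[OF that]] by (simp add: f3 sigma_tgt[OF that])
  have size: "narr s3 ''start'' d - narr s3 ''start'' (d - 1) = length (cls d)"
    if "d \<noteq> 0" "d < B" for d
    using nth_concat_cls(1)[of d] that by (simp add: f3 f2 f1 s0 B_def)
  have sensor: "narr s3 ''sensor'' (narr s3 ''start'' (d - 1) + x) = cls d ! x"
    if "d \<noteq> 0" "d < B" "x < length (cls d)" for d x
    using nth_concat_cls(2)[of d x] that by (simp add: f3 f2 f1 s0 B_def)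
  have ok: "store_ok s3 B (narr s3 ''inv'' (Suc i)) q d \<longleftrightarrow> ok i q d"
    if "i < n" "q < M" "d < B" for i q d
  proof (cases "d = 0")
    case False
    have cls: "cls d \<noteq> []" using cls_nonempty[of d] False that(3) by (simp add: B_def)
    have hd: "narr s3 ''sensor'' (narr s3 ''start'' (d - 1)) = hd (cls d)"
      using sensor[OF False that(3), of 0] cls by (simp add: hd_conv_nth)
    have "hd (cls d) < num_sensors E"
      using cls_sensors[of d "hd (cls d)"] False that(3) cls by (simp add: B_def)
    moreover from this have "tgt (Suc i) * num_sensors E + hd (cls d) < n * num_sensors E"
      using mult_le_mono1[of "Suc (tgt (Suc i))" n "num_sensors E"] tgt_less[OF that(1)] by simp
    ultimately have "narr s3 ''D'' (narr s3 ''row'' (tgt (Suc i)) + hd (cls d)) =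
        of_bool (capable (tgt (Suc i)) d)"
      using s2[OF tgt_less[OF that(1)]] by (simp add: f3 f2 f1 s0 capable_def)
    then show ?thesis
      using False that inv[OF that(1)] s3[OF that(2,3) False] size[OF False that(3)]
      by (simp add: store_ok_def ok_def hd B_def)
  qed (simp add: store_ok_def ok_def)
  have gain: "store_gain s3 (narr s3 ''inv'' (Suc i)) d = gain i d" if "i < n" for i d
    using that inv[OF that] tgt_less[OF that] by (simp add: store_gain_def gain_def f3 f2 f1 s0)
  have v3: "nvar s3 ''B'' = B" "nvar s3 ''M'' = M" "nvar s3 ''n'' = n" "rarr s3 ''H'' = (\<lambda>_. 0)"
    using s1 n1 by (simp_all add: f3 f2) (simp add: f1 s0)
  obtain t4 s4 where e4: "exec dp_prog s3 t4 s4" and t4: "t4 \<le> 3 + n * (9 + M * (10 * B + 11))"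
    and s4: "nvar s4 ''off'' = n * M" "\<forall>x<M. rarr s4 ''H'' x = 0"
      "\<forall>l<n. layer_optimal (store_gain s3 (narr s3 ''inv'' (Suc (n - Suc l))))
        (store_ok s3 B (narr s3 ''inv'' (Suc (n - Suc l)))) B M l s4"
    and f4: "frame dp_prog s3 s4"
    by (rule wpE[OF wp_dp_prog[OF v3 B(2) M]]) blast
  note f4 = frame_nvar[OF f4, unfolded dp_prog_def layer_prog_def choice_prog_def]
    frame_narr[OF f4, unfolded dp_prog_def layer_prog_def choice_prog_def]
    frame_rarr[OF f4, unfolded dp_prog_def layer_prog_def choice_prog_def]
  define V where "V l q = rarr s4 ''H'' (l * M + q)" for l q
  define cd where "cd l q = narr s4 ''cd'' (l * M + q)" for l q
  have V0: "V 0 q = 0" if "q < M" for q using s4(2) that by (simp add: V_def)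
  have best: "is_best (\<lambda>d. V l ((q * B + d) mod M) + gain (n - Suc l) d) (ok (n - Suc l) q) B
        (cd l q) (V (Suc l) q)"
    and next_cell: "narr s4 ''cr'' (l * M + q) = (q * B + cd l q) mod M" if "l < n" "q < M" for l q
  proof -
    have i: "n - Suc l < n" using that(1) by simp
    have "is_best (\<lambda>d. rarr s4 ''H'' (l * M + (q * B + d) mod M) +
          store_gain s3 (narr s3 ''inv'' (Suc (n - Suc l))) d)
        (store_ok s3 B (narr s3 ''inv'' (Suc (n - Suc l))) q) B
        (narr s4 ''cd'' (l * M + q)) (rarr s4 ''H'' (Suc l * M + q))"
      using s4(3) that unfolding layer_optimal_def by blast
    then show "is_best (\<lambda>d. V l ((q * B + d) mod M) + gain (n - Suc l) d) (ok (n - Suc l) q) B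
        (cd l q) (V (Suc l) q)"
      unfolding V_def cd_def gain[OF i] by (subst is_best_cong) (auto simp: ok[OF i that(2)])
    show "narr s4 ''cr'' (l * M + q) = (q * B + cd l q) mod M"
      using s4(3) that unfolding layer_optimal_def cd_def by blast
  qed
  define qs where "qs = rec_nat 0 (\<lambda>i q. narr s4 ''cr'' ((n - Suc i) * M + q))"
  define ds where "ds i = cd (n - Suc i) (qs i)" for i
  have qs0: "qs 0 = 0" and qs_cell: "qs (Suc i) = narr s4 ''cr'' ((n - Suc i) * M + qs i)" for i
    by (simp_all add: qs_def)
  have qs_less: "qs i < M" if "i \<le> n" for i
    using that
  proof (induction i)
    case (Suc i)
    then show ?case using next_cell[of "n - Suc i" "qs i"] M by (simp add: qs_cell)
  qed (simp add: qs0 M)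
  have qs: "qs (Suc i) = (qs i * B + ds i) mod M" if "i < n" for i
    using next_cell[of "n - Suc i" "qs i"] qs_less[of i] that by (simp add: qs_cell ds_def)
  have attained: "(\<Sum>i<n. gain i (ds i)) = V n 0"
    by (rule dp_attained(1)[OF V0 M best qs0 qs ds_def])
  have ds: "ds i < B \<and> ok i (qs i) (ds i)" if "i < n" for i
    by (rule dp_attained(2)[OF V0 M best qs0 qs ds_def that])
  have feas: "feasible ds"
    using feasible_iff_ok[of qs ds, OF assms qs0] qs ds by (simp add: B_def M_def)
  have size4: "narr s4 ''start'' d - narr s4 ''start'' (d - 1) = length (cls d)"
    if "d \<noteq> 0" "d < B" for d
    using size that by (simp add: f4)
  have "wp plan_prog s4 (\<lambda>time s'. time \<le> 3 + n * 11 \<and>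
    (\<forall>i<n. narr s' ''plan'' (narr s4 ''inv'' (Suc i)) =
      (if ds i = 0 then 0
       else narr s4 ''sensor'' (narr s4 ''start'' (ds i - 1) + card {j. j < i \<and> ds j = ds i} mod
         (narr s4 ''start'' (ds i) - narr s4 ''start'' (ds i - 1))) + 1)))"
  proof (rule wp_plan_prog[where M = M and qs = qs])
    show "nvar s4 ''M'' = M" "nvar s4 ''n'' = n" using v3 by (simp_all add: f4)
    show "narr s4 ''ptr'' = (\<lambda>_. 0)" "narr s4 ''plan'' = (\<lambda>_. 0)"
      by (simp_all add: f4 f3 f2) (simp_all add: f1 s0)
    show "narr s4 ''inv'' (Suc i) \<noteq> narr s4 ''inv'' (Suc j)" if "i < j" "j < n" for i j
      using that sigma_tgt[of i] sigma_tgt[of j] inv[of i] inv[of j] by (auto simp: f4)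
    show "0 < narr s4 ''start'' (ds i) - narr s4 ''start'' (ds i - 1)" if "i < n" "ds i \<noteq> 0" for i
      using size4[of "ds i"] ds[OF that(1)] cls_nonempty[of "ds i"] that(2) by (simp add: B_def)
  qed (use s4 qs0 in \<open>simp_all add: qs_cell ds_def cd_def\<close>)
  then obtain t5 s5 where e5: "exec plan_prog s4 t5 s5" and t5: "t5 \<le> 3 + n * 11"
    and s5: "\<forall>i<n. narr s5 ''plan'' (narr s4 ''inv'' (Suc i)) =
      (if ds i = 0 then 0
       else narr s4 ''sensor'' (narr s4 ''start'' (ds i - 1) + card {j. j < i \<and> ds j = ds i} mod
         (narr s4 ''start'' (ds i) - narr s4 ''start'' (ds i - 1))) + 1)"
    by (elim wpE) blast
  have plan: "narr s5 ''plan'' (tgt (Suc i)) = (if ds i = 0 then 0 else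
      cls (ds i) ! (card {j. j < i \<and> ds j = ds i} mod length (cls (ds i))) + 1)" if "i < n" for i
  proof (cases "ds i = 0")
    case True
    then show ?thesis using s5[rule_format, OF that] by (simp add: f4 inv[OF that])
  next
    case False
    have d: "ds i < B" using ds[OF that] by simp
    have "cls (ds i) \<noteq> []" using cls_nonempty[OF False] d by (simp add: B_def)
    then show ?thesis
      using s5[rule_format, OF that] False
      by (simp add: f4 inv[OF that] size[OF False d] sensor[OF False d])
  qed
  have "best_red_response E \<sigma> (output_plan E s5)"
  proof (rule best_red_responseI[OF feas plan])
    show "output_plan E s5 s = {t \<in> targets E. narr s5 ''plan'' t = s + 1}" for s
      by (simp add: output_plan_def)
  next
    fix ds' assume feas': "feasible ds'"
    define qs' where "qs' = rec_nat 0 (\<lambda>i q. (q * B + ds' i) mod M)"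
    have qs': "qs' 0 = 0" "\<And>i. qs' (Suc i) = (qs' i * B + ds' i) mod M"
      by (simp_all add: qs'_def)
    have ds': "ds' i < B" if "i < n" for i
      using feas' that by (auto simp: feasible_def B_def)
    have "ok i (qs' i) (ds' i)" if "i < n" for i
      using feasible_iff_ok[of qs' ds', OF assms qs'(1)] qs'(2) ds' feas' that
      by (simp add: B_def M_def)
    then show "(\<Sum>i<n. gain i (ds' i)) \<le> (\<Sum>i<n. gain i (ds i))"
      unfolding attained using dp_upper[OF V0 M best qs'(1) qs'(2)] ds' by blast
  qed
  moreover have "exec red_response_prog s0 (1 + (t1 + (t2 + (t3 + (t4 + t5))))) s5"
    unfolding red_response_prog_def
    by (rule exec.IfTrue[OF _ exec.Seq[OF e1 exec.Seq[OF e2 exec.Seq[OF e3 exec.Seq[OF e4 e5]]]]])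
      (use assms in \<open>simp add: s0\<close>)
  moreover have "n > 0 \<longrightarrow> 1 + (t1 + (t2 + (t3 + (t4 + t5)))) \<le> 100 * (n * B ^ (\<tau> + 2))"
    using time_bound[OF _ B(1) M_def t1 t2 t3 t4 t5] by simp
  ultimately show ?thesis
    unfolding s0_def B_def
    by (intro exI[of _ "1 + (t1 + (t2 + (t3 + (t4 + t5))))"] exI[of _ s5] conjI)
qed

end

theorem proposition2:
  shows "\<exists>(P :: com) (C :: nat).
    \<forall>(E :: esg) (\<sigma> :: nat \<Rightarrow> nat) (\<tau> :: nat) (gs :: nat list list).
      wf_esg E \<and> recharge E = enat \<tau> \<and> target_ordering E \<sigma> \<and> type_partition E gs \<longrightarrow>
      (\<exists>t st. exec P (input_store E \<sigma> gs) t st \<and>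
        best_red_response E \<sigma> (output_plan E st) \<and>
        (num_targets E > 0 \<longrightarrow> t \<le> C * (num_targets E * (num_types E + 1) ^ (\<tau> + 2))))"
proof (rule exI[of _ red_response_prog], rule exI[of _ 100], intro allI impI)
  fix E \<sigma> \<tau> gs
  assume "wf_esg E \<and> recharge E = enat \<tau> \<and> target_ordering E \<sigma> \<and> type_partition E gs"
  then interpret red_instance E \<sigma> \<tau> gs by unfold_locales auto
  show "\<exists>t st. exec red_response_prog (input_store E \<sigma> gs) t st \<and>
      best_red_response E \<sigma> (output_plan E st) \<and>
      (num_targets E > 0 \<longrightarrow> t \<le> 100 * (num_targets E * (num_types E + 1) ^ (\<tau> + 2)))"
  proof (cases "K = 0")
    case True
    have "2 \<le> 100 * (n * (num_types E + 1) ^ (\<tau> + 2))" if "n > 0"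
      using that by (simp add: num_types_eq True)
    then show ?thesis using exec_no_types[OF True]
      by (intro exI[of _ 2] exI[of _ "input_store E \<sigma> gs"]) blast
  next
    case False
    then show ?thesis using exec_with_types num_types_eq by simp
  qed
qed

end
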